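(* Let $X$ be a metric space and $p\ge1$. Then $F_p(X)$ is the free extended metric Wasserstein algebra of order $p$ over $X$, with universal arrow the Dirac map $\delta:X\to F_p(X)$. That is, for every extended metric Wasserstein algebra $B$ of order $p$ and every nonexpansive map $f:X\to B$ there is a unique nonexpansive affine map $\overline{f}:F_p(X)\to B$ with $\overline{f}\circ\delta=f$.
   Context: An extended metric space is a set with a function $d:X^2\to[0,\infty]$ satisfying the metric axioms, where $x+\infty=\infty+x=\infty$ and $x\le\infty$. Nonexpansive maps satisfy $d(f(x),f(y))\le d(x,y)$. $F_p(X)$ is the set of finitely supported Borel probability measures on $X$ (finite convex combinations of Dirac measures), with the Wasserstein metric $\mathrm{W}_p(\mu,\nu)=\left(\inf_\gamma\int d_X^p\,\mathrm{d}\gamma\right)^{1/p}$ (infimum over couplings $\gamma$, i.e.\ probability measures on $X\times X$ with marginals $\mu,\nu$) and operations $(\mu+_r\nu)(B)=r\mu(B)+(1-r)\nu(B)$. A barycentric algebra is a set with operations $+_r$ ($r\in[0,1]$) satisfying $x+_1y=x$, $x+_rx=x$, $x+_ry=y+_{1-r}x$, and $(x+_py)+_rz=x+_{pr}(y+_{\frac{r-pr}{1-pr}}z)$ for $r<1,p<1$; affine maps preserve all $+_r$. An extended metric Wasserstein algebra of order $p$ is an extended metric space with nonexpansive operations $+_r:X\times X\to X$ (max metric on the product) forming a barycentric algebra and satisfying $d(x+_ry,x'+_ry')^p\le r\,d(x,x')^p+(1-r)\,d(y,y')^p$ for all $x,x',y,y'$ (with the usual conventions for $\infty$). *)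

theory Defs
  imports "HOL-Probability.Giry_Monad"
begin

text \<open>Structures are given by an explicit carrier set; nothing is assumed about
  the distances and operations outside the carrier.\<close>

locale extended_metric_space =
  fixes A :: "'a set" and d :: "'a \<Rightarrow> 'a \<Rightarrow> ennreal"
  assumes zero: "\<lbrakk>x \<in> A; y \<in> A\<rbrakk> \<Longrightarrow> d x y = 0 \<longleftrightarrow> x = y"
    and commute: "\<lbrakk>x \<in> A; y \<in> A\<rbrakk> \<Longrightarrow> d x y = d y x"
    and triangle: "\<lbrakk>x \<in> A; y \<in> A; z \<in> A\<rbrakk> \<Longrightarrow> d x z \<le> d x y + d y z"

definition nonexpansive ::
  "'a set \<Rightarrow> ('a \<Rightarrow> 'a \<Rightarrow> ennreal) \<Rightarrow> 'b set \<Rightarrow> ('b \<Rightarrow> 'b \<Rightarrow> ennreal) \<Rightarrow> ('a \<Rightarrow> 'b) \<Rightarrow> bool"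
  where "nonexpansive A dA B dB f \<longleftrightarrow>
    f \<in> A \<rightarrow> B \<and> (\<forall>x\<in>A. \<forall>y\<in>A. dB (f x) (f y) \<le> dA x y)"

locale barycentric_algebra =
  fixes A :: "'a set" and bary :: "real \<Rightarrow> 'a \<Rightarrow> 'a \<Rightarrow> 'a"
  assumes closed: "\<lbrakk>r \<in> {0..1}; x \<in> A; y \<in> A\<rbrakk> \<Longrightarrow> bary r x y \<in> A"
    and one: "\<lbrakk>x \<in> A; y \<in> A\<rbrakk> \<Longrightarrow> bary 1 x y = x"
    and idem: "\<lbrakk>r \<in> {0..1}; x \<in> A\<rbrakk> \<Longrightarrow> bary r x x = x"
    and skew_commute: "\<lbrakk>r \<in> {0..1}; x \<in> A; y \<in> A\<rbrakk> \<Longrightarrow> bary r x y = bary (1 - r) y x"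
    and skew_assoc: "\<lbrakk>q \<in> {0..<1}; r \<in> {0..<1}; x \<in> A; y \<in> A; z \<in> A\<rbrakk> \<Longrightarrow>
      bary r (bary q x y) z = bary (q * r) x (bary ((r - q * r) / (1 - q * r)) y z)"

definition affine_map ::
  "'a set \<Rightarrow> (real \<Rightarrow> 'a \<Rightarrow> 'a \<Rightarrow> 'a) \<Rightarrow> (real \<Rightarrow> 'b \<Rightarrow> 'b \<Rightarrow> 'b) \<Rightarrow> ('a \<Rightarrow> 'b) \<Rightarrow> bool"
  where "affine_map A baryA baryB f \<longleftrightarrow>
    (\<forall>r\<in>{0..1}. \<forall>x\<in>A. \<forall>y\<in>A. f (baryA r x y) = baryB r (f x) (f y))"

text \<open>Real powers on \<open>[0,\<infinity>]\<close>, for exponents \<open>p > 0\<close> only; \<open>\<infinity>\<close> is sent to \<open>\<infinity>\<close>.\<close>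

definition ennpowr :: "ennreal \<Rightarrow> real \<Rightarrow> ennreal"
  where "ennpowr a p = (if a = \<infinity> then \<infinity> else ennreal (enn2real a powr p))"

text \<open>In \<open>wasserstein\<close> the products follow the convention \<open>0 * \<infinity> = 0\<close> of
  \<^typ>\<open>ennreal\<close>.\<close>

locale wasserstein_algebra =
  extended_metric_space A d + barycentric_algebra A bary
  for p :: real and A :: "'a set" and d :: "'a \<Rightarrow> 'a \<Rightarrow> ennreal"
    and bary :: "real \<Rightarrow> 'a \<Rightarrow> 'a \<Rightarrow> 'a" +
  assumes bary_nonexpansive: "r \<in> {0..1} \<Longrightarrow>
      nonexpansive (A \<times> A) (\<lambda>(x, y) (x', y'). max (d x x') (d y y')) A d (\<lambda>(x, y). bary r x y)"
    and wasserstein: "\<lbrakk>r \<in> {0..1}; x \<in> A; x' \<in> A; y \<in> A; y' \<in> A\<rbrakk> \<Longrightarrow>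
      ennpowr (d (bary r x y) (bary r x' y')) p
        \<le> ennreal r * ennpowr (d x x') p + ennreal (1 - r) * ennpowr (d y y') p"

definition borel_of :: "'a topology \<Rightarrow> 'a measure"
  where "borel_of T = sigma (topspace T) {U. openin T U}"

text \<open>``Finitely supported'' means concentrated on a finite set, i.e. a finite
  convex combination of Dirac measures. (On a non-separable space, finiteness of
  the topological support alone need not imply this.)\<close>

definition fin_prob :: "'a metric \<Rightarrow> 'a measure set"
  where "fin_prob X = {\<mu>. sets \<mu> = sets (borel_of (mtopology_of X)) \<and> prob_space \<mu> \<and>
    (\<exists>S. finite S \<and> S \<subseteq> mspace X \<and> emeasure \<mu> (mspace X - S) = 0)}"

definition dirac :: "'a metric \<Rightarrow> 'a \<Rightarrow> 'a measure"
  where "dirac X x = return (borel_of (mtopology_of X)) x"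

definition mix :: "real \<Rightarrow> 'a measure \<Rightarrow> 'a measure \<Rightarrow> 'a measure"
  where "mix r \<mu> \<nu> = measure_of (space \<mu>) (sets \<mu>)
    (\<lambda>B. ennreal r * emeasure \<mu> B + ennreal (1 - r) * emeasure \<nu> B)"

text \<open>Couplings are Borel measures for the product topology, whose Borel sets
  may properly include the product of the Borel \<open>\<sigma>\<close>-algebras; this makes
  the distance measurable for every \<open>X\<close>.\<close>

definition couplings :: "'a metric \<Rightarrow> 'a measure \<Rightarrow> 'a measure \<Rightarrow> ('a \<times> 'a) measure set"
  where "couplings X \<mu> \<nu> = {\<gamma>.
    sets \<gamma> = sets (borel_of (prod_topology (mtopology_of X) (mtopology_of X))) \<and>
    prob_space \<gamma> \<and>
    distr \<gamma> (borel_of (mtopology_of X)) fst = \<mu> \<and>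
    distr \<gamma> (borel_of (mtopology_of X)) snd = \<nu>}"

definition wasserstein_dist :: "real \<Rightarrow> 'a metric \<Rightarrow> 'a measure \<Rightarrow> 'a measure \<Rightarrow> ennreal"
  where "wasserstein_dist p X \<mu> \<nu> =
    ennpowr (INF \<gamma>\<in>couplings X \<mu> \<nu>. \<integral>\<^sup>+ (x, y). ennreal (mdist X x y powr p) \<partial>\<gamma>) (1 / p)"

end

theory Submission
  imports Defs "HOL-Algebra.FiniteProduct"
begin

text \<open>A finitely supported measure is determined by its weights, so couplings reduce to finite
  transport plans. The triangle inequality for \<open>W\<^sub>p\<close> comes from gluing two plans over
  their common marginal and Minkowski's inequality; the Wasserstein inequality comes from mixing
  plans. For the universal property, a barycentric algebra embeds into a commutative monoid, its
  cone, where finite convex combinations are finite sums and hence well defined. The extension of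
  \<open>f\<close> sends \<open>\<mu>\<close> to the convex combination of the \<open>f x\<close> with weights \<open>\<mu>{x}\<close>. A plan
  for \<open>\<mu>\<close> and \<open>\<nu>\<close> writes both images as combinations with the same weights, and iterating
  the Wasserstein inequality bounds their distance by the cost of the plan.\<close>

text \<open>A Wasserstein algebra need not embed in a vector space. A join semilattice in which
  every mixture with 0 < r < 1 is the join, with infinite distance between distinct points, is one,
  and it is not cancellative. Finite combinations are therefore formed in the cone, where a
  commutative monoid is enough to sum without regard to order. The infimum over couplings is handled
  without optimal plans: upper bounds use plans that are optimal up to some e > 0, lower bounds
  compare with all plans. Weights, plans and barycentres are indexed by an arbitrary finite set
  \<open>U\<close> containing the atoms, so that measures with different atoms share one index set;
  the extra points have weight 0 and drop out. Uniqueness is an induction on \<open>U\<close> that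
  splits off one atom at a time.\<close>

section \<open>Powers on the extended half-line and Minkowski's inequality\<close>

lemma ennpowr_ennreal: "0 \<le> a \<Longrightarrow> ennpowr (ennreal a) p = ennreal (a powr p)"
  by (simp add: ennpowr_def)

lemma ennpowr_0 [simp]: "ennpowr 0 p = 0"
  by (simp add: ennpowr_def)

lemma ennpowr_mono:
  assumes "0 \<le> p" "a \<le> b"
  shows "ennpowr a p \<le> ennpowr b p"
proof (cases "b = \<infinity>")
  case False
  with assms(2) have "a \<noteq> \<infinity>" by (auto simp: top_unique)
  moreover have "enn2real a \<le> enn2real b"
    using assms(2) False by (simp add: enn2real_mono top.not_eq_extremum)
  ultimately show ?thesis
    using False assms by (auto simp: ennpowr_def intro!: ennreal_leI powr_mono2)
qed (simp add: ennpowr_def)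

lemma ennpowr_ennpowr:
  assumes "0 < p"
  shows "ennpowr (ennpowr a p) (1 / p) = a"
  using assms by (cases a) (auto simp: ennpowr_def powr_powr)

text \<open>\<open>ennpowr\<close> with exponent p is an order isomorphism of the extended
  half-line, with inverse exponent 1 / p. The root outside the infimum in
  \<open>wasserstein_dist\<close> can thus be moved to the other side of an inequality, without
  commuting it with the infimum.\<close>

lemma ennpowr_le_iff:
  assumes "0 < p"
  shows "ennpowr a p \<le> b \<longleftrightarrow> a \<le> ennpowr b (1 / p)"
proof
  assume "ennpowr a p \<le> b"
  then have "ennpowr (ennpowr a p) (1 / p) \<le> ennpowr b (1 / p)"
    using assms by (intro ennpowr_mono) auto
  then show "a \<le> ennpowr b (1 / p)" using ennpowr_ennpowr[OF assms] by simp
next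
  assume "a \<le> ennpowr b (1 / p)"
  then have "ennpowr a p \<le> ennpowr (ennpowr b (1 / p)) p"
    using assms by (intro ennpowr_mono) auto
  then show "ennpowr a p \<le> b"
    using ennpowr_ennpowr[of "1 / p" b] assms by simp
qed

lemma powr_convex_combination:
  fixes a b t p :: real
  assumes "p \<ge> 1" "0 \<le> a" "0 \<le> b" "0 \<le> t" "t \<le> 1"
  shows "(t * a + (1 - t) * b) powr p \<le> t * a powr p + (1 - t) * b powr p"
proof -
  \<comment> \<open>Convexity is invoked at positive points only. If one of the two points is 0,
    what remains is \<open>s powr p \<le> s\<close> for s in the unit interval, times
    \<open>c powr p\<close>.\<close>
  have le: "(s * c) powr p \<le> s * c powr p" if "0 \<le> c" "0 \<le> s" "s \<le> 1" for s c :: real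
  proof -
    have "s powr p \<le> s"
      using that assms(1) powr_mono'[of 1 p s] by (cases "s = 0") auto
    then show ?thesis using that by (simp add: powr_mult mult_right_mono)
  qed
  show ?thesis
  proof (cases "a = 0 \<or> b = 0")
    case True
    then show ?thesis using le[of a t] le[of b "1 - t"] assms by auto
  next
    case False
    then have "0 < a" "0 < b" using assms by auto
    from convex_onD[OF powr_convex[OF assms(1)], of t b a] this assms(4,5)
    show ?thesis by (simp add: algebra_simps)
  qed
qed

text \<open>Let A and B be the weighted norms of a and b. Then (a + b) / (A + B) is the convex
  combination of a / A and b / B with weight t = A / (A + B). Convexity of the p-th power bounds it
  pointwise, and the weighted sum of these bounds is 1 because a / A and b / B have norm 1. Norms
  equal to 0 are split off because of the divisions.\<close>

lemma Minkowski_sum: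
  fixes w a b :: "'a \<Rightarrow> real" and p :: real
  assumes "p \<ge> 1" "finite I"
    and nonneg: "\<And>i. i \<in> I \<Longrightarrow> 0 \<le> w i" "\<And>i. i \<in> I \<Longrightarrow> 0 \<le> a i" "\<And>i. i \<in> I \<Longrightarrow> 0 \<le> b i"
  shows "(\<Sum>i\<in>I. w i * (a i + b i) powr p) powr (1 / p)
    \<le> (\<Sum>i\<in>I. w i * a i powr p) powr (1 / p) + (\<Sum>i\<in>I. w i * b i powr p) powr (1 / p)"
proof -
  define S where "S c = (\<Sum>i\<in>I. w i * c i powr p)" for c
  define A where "A = S a powr (1 / p)"
  define B where "B = S b powr (1 / p)"
  have S_nonneg: "0 \<le> S c" for c unfolding S_def using nonneg by (intro sum_nonneg) auto
  have "p > 0" using assms(1) by simp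
  \<comment> \<open>A vanishing norm means that at each index the weight or \<open>a' i\<close> is
    0, so adding \<open>a'\<close> changes no term of the sum.\<close>
  have vanish: "S (\<lambda>i. a' i + b' i) = S b'" if "S a' = 0" for a' b'
    unfolding S_def
  proof (intro sum.cong refl)
    fix i assume "i \<in> I"
    then have "w i * a' i powr p = 0"
      using that nonneg assms(2) unfolding S_def by (subst (asm) sum_nonneg_eq_0_iff) auto
    then show "w i * (a' i + b' i) powr p = w i * b' i powr p" by auto
  qed
  consider "S a = 0" | "S b = 0" | "S a > 0" "S b > 0"
    using S_nonneg by (metis less_eq_real_def)
  then have "S (\<lambda>i. a i + b i) powr (1 / p) \<le> A + B"
  proof cases
    case 1
    then show ?thesis using vanish[OF 1, of b] by (simp add: A_def B_def)
  next
    case 2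
    then show ?thesis using vanish[OF 2, of a] by (simp add: A_def B_def add.commute)
  next
    case 3
    then have AB: "A > 0" "B > 0" by (auto simp: A_def B_def)
    have Ap: "A powr p = S a" "B powr p = S b"
      using \<open>p > 0\<close> S_nonneg by (auto simp: A_def B_def powr_powr)
    define t where "t = A / (A + B)"
    have t: "0 \<le> t" "t \<le> 1" "1 - t = B / (A + B)" using AB by (auto simp: t_def field_simps)
    have bound: "(a i + b i) powr p
        \<le> (A + B) powr p * (t * (a i powr p / S a) + (1 - t) * (b i powr p / S b))" if "i \<in> I" for i
    proof -
      have "t * (a i / A) + (1 - t) * (b i / B) = (a i + b i) / (A + B)"
        unfolding t(3) unfolding t_def using AB by (simp add: add_divide_distrib)
      then have "((a i + b i) / (A + B)) powr p
          \<le> t * (a i / A) powr p + (1 - t) * (b i / B) powr p"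
        using powr_convex_combination[OF assms(1), of "a i / A" "b i / B" t] t nonneg that AB by simp
      then show ?thesis
        using AB nonneg that by (simp add: powr_divide Ap field_simps)
    qed
    have "S (\<lambda>i. a i + b i)
        \<le> (\<Sum>i\<in>I. w i * ((A + B) powr p * (t * (a i powr p / S a) + (1 - t) * (b i powr p / S b))))"
      unfolding S_def[of "\<lambda>i. a i + b i"] using bound nonneg by (intro sum_mono mult_left_mono) auto
    also have "\<dots> = (A + B) powr p"
    proof -
      have "(\<Sum>i\<in>I. w i * ((A + B) powr p * (t * (a i powr p / S a) + (1 - t) * (b i powr p / S b))))
          = (\<Sum>i\<in>I. (A + B) powr p * t / S a * (w i * a i powr p)
              + (A + B) powr p * (1 - t) / S b * (w i * b i powr p))"
        by (intro sum.cong refl) (simp add: algebra_simps)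
      also have "\<dots> = (A + B) powr p * t / S a * S a + (A + B) powr p * (1 - t) / S b * S b"
        unfolding sum.distrib sum_distrib_left[symmetric] by (simp only: S_def)
      also have "\<dots> = (A + B) powr p" using 3 by (simp flip: distrib_left)
      finally show ?thesis .
    qed
    finally have "S (\<lambda>i. a i + b i) powr (1 / p) \<le> ((A + B) powr p) powr (1 / p)"
      using \<open>p > 0\<close> S_nonneg by (intro powr_mono2) auto
    then show ?thesis using AB \<open>p > 0\<close> by (simp add: powr_powr)
  qed
  then show ?thesis by (simp add: S_def A_def B_def)
qed

section \<open>Measures concentrated on finite sets\<close>

lemma space_borel_of [simp]: "space (borel_of T) = topspace T"
  and sets_borel_of: "sets (borel_of T) = sigma_sets (topspace T) {U. openin T U}"
  using openin_subset by (auto simp: borel_of_def space_measure_of_conv intro!: sets_measure_of)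

lemma openin_borel_of: "openin T U \<Longrightarrow> U \<in> sets (borel_of T)"
  by (auto simp: sets_borel_of)

lemma singleton_borel_of:
  assumes "x \<in> mspace X"
  shows "{x} \<in> sets (borel_of (mtopology_of X))"
proof -
  have "t1_space (mtopology_of X)"
    unfolding mtopology_of_def by (rule Metric_space.t1_space_mtopology) simp
  then have "closedin (mtopology_of X) {x}"
    using assms by (simp add: closedin_t1_singleton)
  then have "openin (mtopology_of X) (mspace X - {x})"
    using openin_diff[of "mtopology_of X" "mspace X" "{x}"] by (metis openin_topspace topspace_mtopology_of)
  then have "space (borel_of (mtopology_of X)) - (mspace X - {x}) \<in> sets (borel_of (mtopology_of X))"
    by (intro sets.compl_sets openin_borel_of)
  also have "space (borel_of (mtopology_of X)) - (mspace X - {x}) = {x}" using assms by auto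
  finally show ?thesis .
qed

lemma sets_finite_subset:
  assumes "finite F" "\<And>z. z \<in> F \<Longrightarrow> {z} \<in> sets M"
  shows "F \<in> sets M"
  using assms
proof (induction F)
  case (insert x F)
  then have "{x} \<union> F \<in> sets M" by (intro sets.Un) auto
  then show ?case by simp
qed simp

text \<open>Almost everywhere \<open>\<phi>\<close> agrees with a finite combination of indicators
  of points, which is measurable whatever \<open>\<phi>\<close> is. Powers of the distance can be
  integrated this way directly.\<close>

lemma nn_integral_concentrated:
  assumes "finite F" "\<And>z. z \<in> F \<Longrightarrow> {z} \<in> sets M" "emeasure M (space M - F) = 0"
  shows "(\<integral>\<^sup>+z. \<phi> z \<partial>M) = (\<Sum>z\<in>F. \<phi> z * emeasure M {z})"
proof -
  have "F \<in> sets M" using assms(1,2) by (rule sets_finite_subset)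
  then have "AE z in M. z \<in> F"
    using assms(3) by (intro AE_I[of _ _ "space M - F"]) auto
  then have "(\<integral>\<^sup>+z. \<phi> z \<partial>M) = (\<integral>\<^sup>+z. (\<Sum>y\<in>F. \<phi> y * indicator {y} z) \<partial>M)"
    using assms(1) by (intro nn_integral_cong_AE) (auto elim!: eventually_mono simp: indicator_def)
  also have "\<dots> = (\<Sum>y\<in>F. \<integral>\<^sup>+z. \<phi> y * indicator {y} z \<partial>M)"
    using assms(2) by (intro nn_integral_sum) auto
  also have "\<dots> = (\<Sum>z\<in>F. \<phi> z * emeasure M {z})"
    using assms(2) by (intro sum.cong refl nn_integral_cmult_indicator)
  finally show ?thesis .
qed

lemma emeasure_concentrated:
  assumes "finite F" "\<And>z. z \<in> F \<Longrightarrow> {z} \<in> sets M" "emeasure M (space M - F) = 0" "B \<in> sets M"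
  shows "emeasure M B = (\<Sum>z\<in>F \<inter> B. emeasure M {z})"
proof -
  have "emeasure M B = (\<integral>\<^sup>+z. indicator B z \<partial>M)" using assms(4) by simp
  also have "\<dots> = (\<Sum>z\<in>F. indicator B z * emeasure M {z})"
    by (rule nn_integral_concentrated[OF assms(1-3)])
  also have "\<dots> = (\<Sum>z\<in>F \<inter> B. emeasure M {z})"
    using assms(1) by (intro sum.mono_neutral_cong_right) (auto simp: indicator_def)
  finally show ?thesis .
qed

text \<open>\<open>point_measure\<close> lives on all subsets of \<open>U\<close>. The push-forward
  along the identity transfers it to the Borel sets of \<open>T\<close>, as \<open>fin_prob\<close>
  and \<open>couplings\<close> demand.\<close>

definition discrete_measure :: "'a topology \<Rightarrow> 'a set \<Rightarrow> ('a \<Rightarrow> real) \<Rightarrow> 'a measure"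
  where "discrete_measure T U w = distr (point_measure U (\<lambda>x. ennreal (w x))) (borel_of T) (\<lambda>x. x)"

lemma sets_discrete_measure [simp]: "sets (discrete_measure T U w) = sets (borel_of T)"
  and space_discrete_measure [simp]: "space (discrete_measure T U w) = topspace T"
  by (auto simp: discrete_measure_def)

lemma emeasure_discrete_measure:
  assumes "finite U" "U \<subseteq> topspace T" "\<And>x. x \<in> U \<Longrightarrow> 0 \<le> w x" "B \<in> sets (borel_of T)"
  shows "emeasure (discrete_measure T U w) B = ennreal (\<Sum>x\<in>U \<inter> B. w x)"
proof -
  have "emeasure (discrete_measure T U w) B = emeasure (point_measure U (\<lambda>x. ennreal (w x))) (U \<inter> B)"
    unfolding discrete_measure_def using assms
    by (subst emeasure_distr) (auto simp: space_point_measure Int_commute)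
  also have "\<dots> = ennreal (\<Sum>x\<in>U \<inter> B. w x)"
    using assms by (subst emeasure_point_measure_finite) (auto intro!: sum_ennreal)
  finally show ?thesis .
qed

lemma prob_space_discrete_measure:
  assumes "finite U" "U \<subseteq> topspace T" "\<And>x. x \<in> U \<Longrightarrow> 0 \<le> w x" "(\<Sum>x\<in>U. w x) = 1"
  shows "prob_space (discrete_measure T U w)"
proof
  have "U \<inter> topspace T = U" using assms by auto
  then show "emeasure (discrete_measure T U w) (space (discrete_measure T U w)) = 1"
    using assms emeasure_discrete_measure[where B = "topspace T" and U = U and T = T and w = w]
    by (auto simp: openin_borel_of)
qed

section \<open>Finitely supported probability measures and their weights\<close>

text \<open>The least finite set carrying a measure in \<open>fin_prob X\<close>. Points outside the
  space are excluded automatically: their singletons are not measurable, and \<open>measure\<close>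
  is 0 there.\<close>

definition atoms :: "'a measure \<Rightarrow> 'a set"
  where "atoms \<mu> = {x. measure \<mu> {x} \<noteq> 0}"

lemma fin_probD:
  assumes "\<mu> \<in> fin_prob X"
  shows "sets \<mu> = sets (borel_of (mtopology_of X))" "space \<mu> = mspace X" "prob_space \<mu>"
proof -
  show eq: "sets \<mu> = sets (borel_of (mtopology_of X))" and "prob_space \<mu>"
    using assms by (auto simp: fin_prob_def)
  show "space \<mu> = mspace X" using sets_eq_imp_space_eq[OF eq] by simp
qed

lemma finite_atoms:
  assumes "\<mu> \<in> fin_prob X"
  shows "finite (atoms \<mu>)" "atoms \<mu> \<subseteq> mspace X" "emeasure \<mu> (mspace X - atoms \<mu>) = 0"
proof -
  interpret prob_space \<mu> using fin_probD[OF assms] by simp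
  note [simp] = fin_probD(1,2)[OF assms]
  obtain S where S: "finite S" "S \<subseteq> mspace X" "emeasure \<mu> (mspace X - S) = 0"
    using assms by (auto simp: fin_prob_def)
  have sing: "{z} \<in> sets \<mu>" if "z \<in> mspace X" for z using that by (simp add: singleton_borel_of)
  have conc: "emeasure \<mu> B = (\<Sum>z\<in>S \<inter> B. emeasure \<mu> {z})" if "B \<in> sets \<mu>" for B
    using S sing that by (intro emeasure_concentrated) auto
  have sub: "atoms \<mu> \<subseteq> S"
  proof
    fix x assume x: "x \<in> atoms \<mu>"
    then have "{x} \<in> sets \<mu>" unfolding atoms_def using measure_notin_sets by blast
    then show "x \<in> S" using conc[of "{x}"] x by (cases "x \<in> S") (auto simp: atoms_def emeasure_eq_measure)
  qed
  then show "finite (atoms \<mu>)" "atoms \<mu> \<subseteq> mspace X" using S finite_subset by auto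
  then have "atoms \<mu> \<in> sets \<mu>" using sing by (auto intro: sets_finite_subset[of "atoms \<mu>"])
  then have "mspace X - atoms \<mu> \<in> sets \<mu>" using fin_probD(2)[OF assms] by (metis sets.compl_sets)
  from conc[OF this] show "emeasure \<mu> (mspace X - atoms \<mu>) = 0"
    by (auto simp: atoms_def emeasure_eq_measure intro!: sum.neutral)
qed

text \<open>Formulated for every finite \<open>U\<close> containing the atoms, so that several
  measures can be summed over the same set; the added points have weight 0.\<close>

lemma emeasure_fin_prob:
  assumes "\<mu> \<in> fin_prob X" "finite U" "atoms \<mu> \<subseteq> U" "B \<in> sets \<mu>"
  shows "emeasure \<mu> B = ennreal (\<Sum>x\<in>U \<inter> B. measure \<mu> {x})"
proof -
  interpret prob_space \<mu> using fin_probD[OF assms(1)] by simp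
  have "emeasure \<mu> B = (\<Sum>z\<in>atoms \<mu> \<inter> B. emeasure \<mu> {z})"
    using finite_atoms[OF assms(1)] fin_probD[OF assms(1)] assms(4)
    by (intro emeasure_concentrated) (auto intro: singleton_borel_of)
  also have "\<dots> = ennreal (\<Sum>x\<in>atoms \<mu> \<inter> B. measure \<mu> {x})"
    by (simp add: emeasure_eq_measure sum_ennreal)
  also have "(\<Sum>x\<in>atoms \<mu> \<inter> B. measure \<mu> {x}) = (\<Sum>x\<in>U \<inter> B. measure \<mu> {x})"
    using assms by (intro sum.mono_neutral_left) (auto simp: atoms_def)
  finally show ?thesis .
qed

lemma sum_weights:
  assumes "\<mu> \<in> fin_prob X" "finite U" "atoms \<mu> \<subseteq> U"
  shows "(\<Sum>x\<in>U. measure \<mu> {x}) = 1"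
proof -
  interpret prob_space \<mu> using fin_probD[OF assms(1)] by simp
  have "ennreal (\<Sum>x\<in>U \<inter> space \<mu>. measure \<mu> {x}) = 1"
    using emeasure_fin_prob[OF assms, of "space \<mu>"] emeasure_space_1 by simp
  moreover have "(\<Sum>x\<in>U \<inter> space \<mu>. measure \<mu> {x}) = (\<Sum>x\<in>U. measure \<mu> {x})"
    using finite_atoms[OF assms(1)] fin_probD[OF assms(1)] assms
    by (intro sum.mono_neutral_left) (auto simp: atoms_def)
  ultimately show ?thesis by simp
qed

text \<open>Turns equations between measures into pointwise equations between reals. All laws of
  \<open>mix\<close> are proved through it.\<close>

lemma fin_prob_eqI:
  assumes "\<mu> \<in> fin_prob X" "\<nu> \<in> fin_prob X"
    and "\<And>x. x \<in> mspace X \<Longrightarrow> measure \<mu> {x} = measure \<nu> {x}"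
  shows "\<mu> = \<nu>"
proof (rule measure_eqI)
  show eq: "sets \<mu> = sets \<nu>" using fin_probD(1) assms(1,2) by metis
  fix B assume B: "B \<in> sets \<mu>"
  let ?U = "atoms \<mu> \<union> atoms \<nu>"
  have "?U \<subseteq> mspace X" using finite_atoms(2)[OF assms(1)] finite_atoms(2)[OF assms(2)] by auto
  then have "(\<Sum>x\<in>?U \<inter> B. measure \<mu> {x}) = (\<Sum>x\<in>?U \<inter> B. measure \<nu> {x})"
    using assms(3) by (intro sum.cong) auto
  then show "emeasure \<mu> B = emeasure \<nu> B"
    using emeasure_fin_prob[OF assms(1), of ?U B] emeasure_fin_prob[OF assms(2), of ?U B]
      finite_atoms(1)[OF assms(1)] finite_atoms(1)[OF assms(2)] B eq by auto
qed

lemma discrete_measure_fin_prob: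
  assumes "finite U" "U \<subseteq> mspace X" "\<And>x. x \<in> U \<Longrightarrow> 0 \<le> w x" "(\<Sum>x\<in>U. w x) = 1"
  shows "discrete_measure (mtopology_of X) U w \<in> fin_prob X"
proof -
  have "U \<in> sets (borel_of (mtopology_of X))"
    using assms(1,2) singleton_borel_of[of _ X] by (auto intro: sets_finite_subset[of U])
  then have "mspace X - U \<in> sets (borel_of (mtopology_of X))"
    by (metis sets.compl_sets space_borel_of topspace_mtopology_of)
  then have "emeasure (discrete_measure (mtopology_of X) U w) (mspace X - U) = 0"
    using assms by (subst emeasure_discrete_measure) auto
  then show ?thesis
    using assms prob_space_discrete_measure[of U "mtopology_of X" w] unfolding fin_prob_def by auto
qed

lemma measure_discrete_measure:
  assumes "finite U" "U \<subseteq> mspace X" "\<And>x. x \<in> U \<Longrightarrow> 0 \<le> w x" "x \<in> mspace X"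
  shows "measure (discrete_measure (mtopology_of X) U w) {x} = (if x \<in> U then w x else 0)"
  using assms emeasure_discrete_measure[of U "mtopology_of X" w "{x}"]
  by (auto simp: measure_def singleton_borel_of)

section \<open>Dirac measures and mixtures\<close>

lemma measure_dirac:
  assumes "x \<in> mspace X" "y \<in> mspace X"
  shows "measure (dirac X x) {y} = (if x = y then 1 else 0)"
  using assms by (auto simp: dirac_def measure_return singleton_borel_of)

lemma dirac_fin_prob:
  assumes "x \<in> mspace X"
  shows "dirac X x \<in> fin_prob X"
proof -
  have "mspace X - {x} \<in> sets (borel_of (mtopology_of X))"
    by (metis assms sets.compl_sets space_borel_of topspace_mtopology_of singleton_borel_of)
  then have "emeasure (dirac X x) (mspace X - {x}) = 0"
    by (simp add: dirac_def)
  moreover have "prob_space (dirac X x)" using assms by (simp add: dirac_def prob_space_return)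
  ultimately show ?thesis
    using assms unfolding fin_prob_def by (auto simp: dirac_def intro!: exI[of _ "{x}"])
qed

lemma emeasure_mix:
  assumes "sets \<nu> = sets \<mu>" "B \<in> sets \<mu>"
  shows "emeasure (mix r \<mu> \<nu>) B = ennreal r * emeasure \<mu> B + ennreal (1 - r) * emeasure \<nu> B"
  unfolding mix_def
proof (rule emeasure_measure_of_sigma)
  show "countably_additive (sets \<mu>) (\<lambda>B. ennreal r * emeasure \<mu> B + ennreal (1 - r) * emeasure \<nu> B)"
  proof (rule countably_additiveI)
    fix A :: "nat \<Rightarrow> _" assume A: "range A \<subseteq> sets \<mu>" "disjoint_family A"
    then have "(\<Sum>i. emeasure \<mu> (A i)) = emeasure \<mu> (\<Union>i. A i)" "(\<Sum>i. emeasure \<nu> (A i)) = emeasure \<nu> (\<Union>i. A i)"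
      using assms(1) by (auto intro!: suminf_emeasure)
    then show "(\<Sum>i. ennreal r * emeasure \<mu> (A i) + ennreal (1 - r) * emeasure \<nu> (A i))
        = ennreal r * emeasure \<mu> (\<Union>i. A i) + ennreal (1 - r) * emeasure \<nu> (\<Union>i. A i)"
      by (subst suminf_add[symmetric]) auto
  qed
qed (use assms in \<open>auto simp: positive_def sets.sigma_algebra_axioms\<close>)

lemma mix_fin_prob:
  assumes "\<mu> \<in> fin_prob X" "\<nu> \<in> fin_prob X" "r \<in> {0..1}"
  shows "mix r \<mu> \<nu> \<in> fin_prob X"
    and "measure (mix r \<mu> \<nu>) {x} = r * measure \<mu> {x} + (1 - r) * measure \<nu> {x}"
proof -
  interpret \<mu>: prob_space \<mu> using fin_probD assms by blast
  interpret \<nu>: prob_space \<nu> using fin_probD assms by blast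
  have eq: "sets \<nu> = sets \<mu>" "space \<nu> = space \<mu>" using fin_probD assms(1,2) by metis+
  have sets_mix: "sets (mix r \<mu> \<nu>) = sets \<mu>" and space_mix: "space (mix r \<mu> \<nu>) = space \<mu>"
    by (auto simp: mix_def sets.sets_measure_of_eq space_measure_of_conv)
  have em: "emeasure (mix r \<mu> \<nu>) B = ennreal (r * measure \<mu> B + (1 - r) * measure \<nu> B)"
    if "B \<in> sets \<mu>" for B
    using emeasure_mix[OF eq(1) that, of r] assms(3)
    by (simp add: \<mu>.emeasure_eq_measure \<nu>.emeasure_eq_measure ennreal_mult ennreal_plus)
  let ?U = "atoms \<mu> \<union> atoms \<nu>"
  have U: "finite ?U" "?U \<subseteq> mspace X"
    using finite_atoms(1,2)[OF assms(1)] finite_atoms(1,2)[OF assms(2)] by auto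
  then have "?U \<in> sets \<mu>"
    using fin_probD(1)[OF assms(1)] singleton_borel_of[of _ X]
    by (intro sets_finite_subset[of ?U]) auto
  then have DU: "mspace X - ?U \<in> sets \<mu>" using fin_probD(2)[OF assms(1)] by (metis sets.compl_sets)
  have "measure \<mu> (mspace X - ?U) = 0" "measure \<nu> (mspace X - ?U) = 0"
    using emeasure_fin_prob[OF assms(1) U(1) _ DU] emeasure_fin_prob[OF assms(2) U(1)] DU eq
    by (auto simp: measure_def)
  then have "emeasure (mix r \<mu> \<nu>) (mspace X - ?U) = 0" using em[OF DU] by simp
  moreover have "prob_space (mix r \<mu> \<nu>)"
    using em[of "space \<mu>"] \<mu>.prob_space \<nu>.prob_space eq
    by (intro prob_spaceI) (simp add: space_mix)
  ultimately show "mix r \<mu> \<nu> \<in> fin_prob X"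
    using U sets_mix fin_probD[OF assms(1)] unfolding fin_prob_def by auto
  show "measure (mix r \<mu> \<nu>) {x} = r * measure \<mu> {x} + (1 - r) * measure \<nu> {x}"
  proof (cases "{x} \<in> sets \<mu>")
    case True
    show ?thesis
      unfolding measure_def[of "mix r \<mu> \<nu>"] em[OF True]
      using assms(3) by (intro enn2real_ennreal) auto
  next
    case False
    then show ?thesis using sets_mix eq by (simp add: measure_notin_sets)
  qed
qed

text \<open>At each point, every law becomes an identity between convex combinations of real
  numbers.\<close>

lemma barycentric_algebra_fin_prob: "barycentric_algebra (fin_prob X) mix"
proof
  fix q r :: real and x y z :: "'a measure"
  assume qr: "q \<in> {0..<1}" "r \<in> {0..<1}" and xyz: "x \<in> fin_prob X" "y \<in> fin_prob X" "z \<in> fin_prob X"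
  have qr1: "q * r < 1" using qr mult_strict_mono[of q 1 r 1] by auto
  define s where "s = (r - q * r) / (1 - q * r)"
  have "q * r \<le> r" using qr mult_right_mono[of q 1 r] by auto
  then have s: "s \<in> {0..1}" using qr qr1 by (auto simp: s_def field_simps)
  \<comment> \<open>With the denominator cleared, both groupings visibly give y the weight r - q * r
    and z the weight 1 - r.\<close>
  have sq: "(1 - q * r) * s = r - q * r" using qr1 by (simp add: s_def)
  have qr': "q * r \<in> {0..1}" using qr qr1 by auto
  have qr01: "r \<in> {0..1}" "q \<in> {0..1}" using qr by auto
  have mem: "mix q x y \<in> fin_prob X" "mix s y z \<in> fin_prob X"
    using xyz qr01 s by (auto intro!: mix_fin_prob(1))
  have "mix r (mix q x y) z = mix (q * r) x (mix s y z)"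
  proof (rule fin_prob_eqI)
    show "mix r (mix q x y) z \<in> fin_prob X" "mix (q * r) x (mix s y z) \<in> fin_prob X"
      using xyz qr01 qr' mem by (auto intro!: mix_fin_prob(1))
    fix a
    have "(1 - q * r) * (s * measure y {a} + (1 - s) * measure z {a})
        = ((1 - q * r) * s) * measure y {a} + ((1 - q * r) - (1 - q * r) * s) * measure z {a}"
      by (simp add: algebra_simps)
    also have "\<dots> = (r - q * r) * measure y {a} + (1 - r) * measure z {a}" unfolding sq by simp
    finally show "measure (mix r (mix q x y) z) {a} = measure (mix (q * r) x (mix s y z)) {a}"
      unfolding mix_fin_prob(2)[OF mem(1) xyz(3) qr01(1)] mix_fin_prob(2)[OF xyz(1) mem(2) qr']
        mix_fin_prob(2)[OF xyz(1,2) qr01(2)] mix_fin_prob(2)[OF xyz(2,3) s]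
      by (simp add: algebra_simps)
  qed
  then show "mix r (mix q x y) z = mix (q * r) x (mix ((r - q * r) / (1 - q * r)) y z)"
    by (simp add: s_def)
next
  fix r :: real and x y :: "'a measure"
  assume r: "r \<in> {0..1}" and xy: "x \<in> fin_prob X" "y \<in> fin_prob X"
  have r': "1 - r \<in> {0..1}" using r by auto
  show "mix r x y \<in> fin_prob X" using mix_fin_prob(1)[OF xy r] .
  show "mix r x y = mix (1 - r) y x"
    by (rule fin_prob_eqI[OF mix_fin_prob(1)[OF xy r] mix_fin_prob(1)[OF xy(2,1) r']])
      (simp add: mix_fin_prob(2)[OF xy r] mix_fin_prob(2)[OF xy(2,1) r'])
  show "mix r x x = x"
    by (rule fin_prob_eqI[OF mix_fin_prob(1)[OF xy(1,1) r] xy(1)])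
      (simp add: mix_fin_prob(2)[OF xy(1,1) r] algebra_simps)
next
  fix x y :: "'a measure"
  assume xy: "x \<in> fin_prob X" "y \<in> fin_prob X"
  have 1: "(1::real) \<in> {0..1}" by simp
  show "mix 1 x y = x"
    by (rule fin_prob_eqI[OF mix_fin_prob(1)[OF xy 1] xy(1)]) (simp add: mix_fin_prob(2)[OF xy 1])
qed

section \<open>Transport plans\<close>

abbreviation wt :: "'a measure \<Rightarrow> 'a \<Rightarrow> real"
  where "wt \<mu> \<equiv> \<lambda>x. measure \<mu> {x}"

definition plan :: "'a set \<Rightarrow> ('a \<Rightarrow> real) \<Rightarrow> ('a \<Rightarrow> real) \<Rightarrow> ('a \<Rightarrow> 'a \<Rightarrow> real) \<Rightarrow> bool"
  where "plan U m n g \<longleftrightarrow> (\<forall>x\<in>U. \<forall>y\<in>U. 0 \<le> g x y) \<and>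
    (\<forall>x\<in>U. (\<Sum>y\<in>U. g x y) = m x) \<and> (\<forall>y\<in>U. (\<Sum>x\<in>U. g x y) = n y)"

definition cost :: "real \<Rightarrow> 'a metric \<Rightarrow> 'a set \<Rightarrow> ('a \<Rightarrow> 'a \<Rightarrow> real) \<Rightarrow> real"
  where "cost p X U g = (\<Sum>x\<in>U. \<Sum>y\<in>U. g x y * mdist X x y powr p)"

lemma cost_nonneg:
  assumes "plan U m n g"
  shows "0 \<le> cost p X U g"
  using assms unfolding cost_def plan_def by (intro sum_nonneg) auto

lemma plan_flip: "plan U m n g \<Longrightarrow> plan U n m (\<lambda>x y. g y x)"
  by (auto simp: plan_def)

lemma cost_flip: "cost p X U (\<lambda>x y. g y x) = cost p X U g"
  unfolding cost_def by (subst sum.swap) (simp add: mdist_commute)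

lemma measurable_borel_of:
  assumes "continuous_map S T f" "sets M = sets (borel_of S)"
  shows "f \<in> measurable M (borel_of T)"
  unfolding borel_of_def
proof (rule measurable_measure_of)
  have sp: "space M = topspace S" using sets_eq_imp_space_eq[OF assms(2)] by simp
  show "{U. openin T U} \<subseteq> Pow (topspace T)" using openin_subset by auto
  show "f \<in> space M \<rightarrow> topspace T"
    using continuous_map_funspace[OF assms(1)] by (simp add: sp)
  fix U assume "U \<in> {U. openin T U}"
  then have "openin S {x \<in> topspace S. f x \<in> U}"
    using assms(1) openin_continuous_map_preimage by blast
  also have "{x \<in> topspace S. f x \<in> U} = f -` U \<inter> space M" by (auto simp: sp)
  finally show "f -` U \<inter> space M \<in> sets M" unfolding assms(2) by (rule openin_borel_of)
qed

section \<open>Couplings and plans on a common finite set\<close>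

context
  fixes X :: "'a metric" and U :: "'a set" and \<mu> \<nu> :: "'a measure"
  assumes U: "finite U" "U \<subseteq> mspace X"
    and \<mu>: "\<mu> \<in> fin_prob X" "atoms \<mu> \<subseteq> U"
    and \<nu>: "\<nu> \<in> fin_prob X" "atoms \<nu> \<subseteq> U"
begin

text \<open>The complement of \<open>U \<times> U\<close> is the union of the preimages of the null
  set \<open>mspace X - U\<close> under the two projections. So a coupling lives on
  \<open>U \<times> U\<close>, its marginal conditions become row and column sums, and its integral
  becomes a finite sum.\<close>

lemma
  assumes "\<gamma> \<in> couplings X \<mu> \<nu>"
  shows plan_of_coupling: "plan U (wt \<mu>) (wt \<nu>) (\<lambda>x y. measure \<gamma> {(x, y)})"
    and integral_coupling: "(\<integral>\<^sup>+ (x, y). ennreal (mdist X x y powr p) \<partial>\<gamma>)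
      = ennreal (cost p X U (\<lambda>x y. measure \<gamma> {(x, y)}))"
proof -
  let ?T = "mtopology_of X" and ?S = "mspace X"
  \<comment> \<open>The product topology is the metric topology of \<open>prod_metric X X\<close>,
    so \<open>singleton_borel_of\<close> also makes single pairs measurable.\<close>
  have sets: "sets \<gamma> = sets (borel_of (mtopology_of (prod_metric X X)))"
    and fst: "distr \<gamma> (borel_of ?T) fst = \<mu>" and snd: "distr \<gamma> (borel_of ?T) snd = \<nu>"
    and "prob_space \<gamma>"
    using assms by (auto simp: couplings_def)
  interpret prob_space \<gamma> by fact
  have sp: "space \<gamma> = ?S \<times> ?S" using sets_eq_imp_space_eq[OF sets] by simp
  have meas: "fst \<in> measurable \<gamma> (borel_of ?T)" "snd \<in> measurable \<gamma> (borel_of ?T)"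
    by (rule measurable_borel_of[OF _ sets]; simp add: continuous_map_fst continuous_map_snd)+
  have sing: "{z} \<in> sets \<gamma>" if "z \<in> U \<times> U" for z
    using that U(2) unfolding sets by (intro singleton_borel_of) auto
  have em_fst: "emeasure \<mu> B = emeasure \<gamma> (fst -` B \<inter> space \<gamma>)" if "B \<in> sets \<mu>" for B
    using emeasure_distr[OF meas(1), of B] that fst fin_probD(1)[OF \<mu>(1)] by simp
  have em_snd: "emeasure \<nu> B = emeasure \<gamma> (snd -` B \<inter> space \<gamma>)" if "B \<in> sets \<nu>" for B
    using emeasure_distr[OF meas(2), of B] that snd fin_probD(1)[OF \<nu>(1)] by simp
  have "U \<in> sets (borel_of ?T)"
    using U singleton_borel_of[of _ X] by (auto intro: sets_finite_subset[of U])
  then have DU: "?S - U \<in> sets (borel_of ?T)"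
    by (metis sets.compl_sets space_borel_of topspace_mtopology_of)
  have "emeasure \<mu> (?S - U) = 0" "emeasure \<nu> (?S - U) = 0"
    using DU emeasure_fin_prob[OF \<mu>(1) U(1) \<mu>(2), of "?S - U"]
      emeasure_fin_prob[OF \<nu>(1) U(1) \<nu>(2), of "?S - U"]
      fin_probD(1)[OF \<mu>(1)] fin_probD(1)[OF \<nu>(1)] by auto
  then have "fst -` (?S - U) \<inter> space \<gamma> \<in> null_sets \<gamma>" "snd -` (?S - U) \<inter> space \<gamma> \<in> null_sets \<gamma>"
    using em_fst[of "?S - U"] em_snd[of "?S - U"] DU measurable_sets[OF meas(1) DU]
      measurable_sets[OF meas(2) DU] fin_probD(1)[OF \<mu>(1)] fin_probD(1)[OF \<nu>(1)] by auto
  then have "(fst -` (?S - U) \<inter> space \<gamma>) \<union> (snd -` (?S - U) \<inter> space \<gamma>) \<in> null_sets \<gamma>"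
    by (rule null_sets.Un)
  also have "(fst -` (?S - U) \<inter> space \<gamma>) \<union> (snd -` (?S - U) \<inter> space \<gamma>) = space \<gamma> - U \<times> U"
    by (auto simp: sp)
  finally have null: "emeasure \<gamma> (space \<gamma> - U \<times> U) = 0" by auto
  note UU = finite_cartesian_product[OF U(1) U(1)] sing null
  have conc: "emeasure \<gamma> B = ennreal (\<Sum>z\<in>U \<times> U \<inter> B. measure \<gamma> {z})" if "B \<in> sets \<gamma>" for B
    using emeasure_concentrated[OF UU that] by (simp add: emeasure_eq_measure sum_ennreal)
  show "plan U (wt \<mu>) (wt \<nu>) (\<lambda>x y. measure \<gamma> {(x, y)})"
    unfolding plan_def
  proof (intro conjI ballI)
    fix a assume a: "a \<in> U"
    then have B: "{a} \<in> sets (borel_of ?T)" using U(2) by (intro singleton_borel_of) auto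
    have "U \<times> U \<inter> (fst -` {a} \<inter> space \<gamma>) = Pair a ` U" using a U(2) by (auto simp: sp)
    then have "emeasure \<mu> {a} = ennreal (\<Sum>y\<in>U. measure \<gamma> {(a, y)})"
      using em_fst[of "{a}"] conc[OF measurable_sets[OF meas(1) B]] B fin_probD(1)[OF \<mu>(1)]
      by (simp add: sum.reindex inj_on_def)
    then show "(\<Sum>y\<in>U. measure \<gamma> {(a, y)}) = wt \<mu> a" by (simp add: measure_def[of \<mu>] sum_nonneg)
    have "U \<times> U \<inter> (snd -` {a} \<inter> space \<gamma>) = (\<lambda>x. (x, a)) ` U" using a U(2) by (auto simp: sp)
    then have "emeasure \<nu> {a} = ennreal (\<Sum>x\<in>U. measure \<gamma> {(x, a)})"
      using em_snd[of "{a}"] conc[OF measurable_sets[OF meas(2) B]] B fin_probD(1)[OF \<nu>(1)]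
      by (simp add: sum.reindex inj_on_def)
    then show "(\<Sum>x\<in>U. measure \<gamma> {(x, a)}) = wt \<nu> a" by (simp add: measure_def[of \<nu>] sum_nonneg)
  qed simp
  have "(\<integral>\<^sup>+ (x, y). ennreal (mdist X x y powr p) \<partial>\<gamma>)
      = (\<Sum>z\<in>U \<times> U. (case z of (x, y) \<Rightarrow> ennreal (mdist X x y powr p)) * emeasure \<gamma> {z})"
    by (rule nn_integral_concentrated[OF UU])
  also have "\<dots> = (\<Sum>z\<in>U \<times> U. ennreal (measure \<gamma> {z} * mdist X (fst z) (snd z) powr p))"
    by (simp add: emeasure_eq_measure ennreal_mult' case_prod_beta mult.commute)
  also have "\<dots> = ennreal (cost p X U (\<lambda>x y. measure \<gamma> {(x, y)}))"
    unfolding cost_def sum.cartesian_product by (simp add: case_prod_beta sum_ennreal)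
  finally show "(\<integral>\<^sup>+ (x, y). ennreal (mdist X x y powr p) \<partial>\<gamma>)
      = ennreal (cost p X U (\<lambda>x y. measure \<gamma> {(x, y)}))" .
qed

text \<open>Placing mass \<open>g x y\<close> at the pair (x, y) gives the coupling. Its marginals
  are right because the preimage of \<open>B\<close> under a projection meets
  \<open>U \<times> U\<close> in a union of full rows or full columns.\<close>

lemma coupling_of_plan:
  assumes "plan U (wt \<mu>) (wt \<nu>) g"
  shows "\<exists>\<gamma>\<in>couplings X \<mu> \<nu>. (\<integral>\<^sup>+ (x, y). ennreal (mdist X x y powr p) \<partial>\<gamma>) = ennreal (cost p X U g)"
proof -
  let ?T = "mtopology_of X" and ?S = "mspace X"
  define \<gamma> where "\<gamma> = discrete_measure (mtopology_of (prod_metric X X)) (U \<times> U) (\<lambda>(x, y). g x y)"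
  have g: "0 \<le> g x y" if "x \<in> U" "y \<in> U" for x y using assms that by (auto simp: plan_def)
  have sets: "sets \<gamma> = sets (borel_of (mtopology_of (prod_metric X X)))"
    and sp: "space \<gamma> = ?S \<times> ?S" by (simp_all add: \<gamma>_def)
  have UU: "finite (U \<times> U)" "U \<times> U \<subseteq> topspace (mtopology_of (prod_metric X X))" using U by auto
  have em: "emeasure \<gamma> B = ennreal (\<Sum>(x, y)\<in>U \<times> U \<inter> B. g x y)" if "B \<in> sets \<gamma>" for B
    using emeasure_discrete_measure[OF UU, of "\<lambda>(x, y). g x y" B] g that by (auto simp: \<gamma>_def)
  have meas: "fst \<in> measurable \<gamma> (borel_of ?T)" "snd \<in> measurable \<gamma> (borel_of ?T)"
    by (rule measurable_borel_of[OF _ sets]; simp add: continuous_map_fst continuous_map_snd)+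
  have "distr \<gamma> (borel_of ?T) fst = \<mu>"
  proof (rule measure_eqI)
    fix B assume "B \<in> sets (distr \<gamma> (borel_of ?T) fst)"
    then have B: "B \<in> sets (borel_of ?T)" by simp
    have eq: "U \<times> U \<inter> (fst -` B \<inter> space \<gamma>) = (U \<inter> B) \<times> U" using U(2) by (auto simp: sp)
    have "(\<Sum>(x, y)\<in>(U \<inter> B) \<times> U. g x y) = (\<Sum>x\<in>U \<inter> B. wt \<mu> x)"
      using assms by (simp add: plan_def flip: sum.cartesian_product)
    then show "emeasure (distr \<gamma> (borel_of ?T) fst) B = emeasure \<mu> B"
      using emeasure_distr[OF meas(1) B] em[OF measurable_sets[OF meas(1) B]] eq
        emeasure_fin_prob[OF \<mu>(1) U(1) \<mu>(2), of B] B fin_probD(1)[OF \<mu>(1)] by simp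
  qed (simp add: fin_probD(1)[OF \<mu>(1)])
  moreover have "distr \<gamma> (borel_of ?T) snd = \<nu>"
  proof (rule measure_eqI)
    fix B assume "B \<in> sets (distr \<gamma> (borel_of ?T) snd)"
    then have B: "B \<in> sets (borel_of ?T)" by simp
    have eq: "U \<times> U \<inter> (snd -` B \<inter> space \<gamma>) = U \<times> (U \<inter> B)" using U(2) by (auto simp: sp)
    have "(\<Sum>(x, y)\<in>U \<times> (U \<inter> B). g x y) = (\<Sum>y\<in>U \<inter> B. \<Sum>x\<in>U. g x y)"
      unfolding sum.cartesian_product[symmetric] by (rule sum.swap)
    then have "(\<Sum>(x, y)\<in>U \<times> (U \<inter> B). g x y) = (\<Sum>x\<in>U \<inter> B. wt \<nu> x)"
      using assms by (simp add: plan_def)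
    then show "emeasure (distr \<gamma> (borel_of ?T) snd) B = emeasure \<nu> B"
      using emeasure_distr[OF meas(2) B] em[OF measurable_sets[OF meas(2) B]] eq
        emeasure_fin_prob[OF \<nu>(1) U(1) \<nu>(2), of B] B fin_probD(1)[OF \<nu>(1)] by simp
  qed (simp add: fin_probD(1)[OF \<nu>(1)])
  moreover have "prob_space \<gamma>"
    unfolding \<gamma>_def
  proof (rule prob_space_discrete_measure[OF UU])
    show "(\<Sum>z\<in>U \<times> U. case z of (x, y) \<Rightarrow> g x y) = 1"
      using assms sum_weights[OF \<mu>(1) U(1) \<mu>(2)] by (simp add: plan_def flip: sum.cartesian_product)
  qed (use g in auto)
  ultimately have mem: "\<gamma> \<in> couplings X \<mu> \<nu>" by (simp add: couplings_def \<gamma>_def)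
  have sing: "{z} \<in> sets \<gamma>" if "z \<in> U \<times> U" for z
    using that U(2) unfolding sets by (intro singleton_borel_of) auto
  have "U \<times> U \<in> sets \<gamma>" using UU sing by (auto intro: sets_finite_subset[of "U \<times> U"])
  then have "emeasure \<gamma> (space \<gamma> - U \<times> U) = 0" using em[of "space \<gamma> - U \<times> U"] by auto
  then have "(\<integral>\<^sup>+ (x, y). ennreal (mdist X x y powr p) \<partial>\<gamma>)
      = (\<Sum>z\<in>U \<times> U. (case z of (x, y) \<Rightarrow> ennreal (mdist X x y powr p)) * emeasure \<gamma> {z})"
    using UU(1) sing by (intro nn_integral_concentrated)
  also have "\<dots> = (\<Sum>z\<in>U \<times> U. ennreal (g (fst z) (snd z) * mdist X (fst z) (snd z) powr p))"
    using em sing g by (intro sum.cong refl) (auto simp: ennreal_mult' mult.commute)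
  also have "\<dots> = ennreal (cost p X U g)"
    unfolding cost_def sum.cartesian_product using g by (subst sum_ennreal) (auto simp: case_prod_beta)
  finally show ?thesis using mem by blast
qed

section \<open>The distance as an infimum over plans\<close>

context
  fixes p :: real
  assumes p: "p \<ge> 1"
begin

lemma wasserstein_dist_le:
  assumes "plan U (wt \<mu>) (wt \<nu>) g"
  shows "wasserstein_dist p X \<mu> \<nu> \<le> ennreal (cost p X U g powr (1 / p))"
proof -
  obtain \<gamma> where "\<gamma> \<in> couplings X \<mu> \<nu>"
    "(\<integral>\<^sup>+ (x, y). ennreal (mdist X x y powr p) \<partial>\<gamma>) = ennreal (cost p X U g)"
    using coupling_of_plan[OF assms] by blast
  then have "(INF \<gamma>\<in>couplings X \<mu> \<nu>. \<integral>\<^sup>+ (x, y). ennreal (mdist X x y powr p) \<partial>\<gamma>) \<le> ennreal (cost p X U g)"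
    by (metis (no_types, lifting) INF_lower)
  then have "wasserstein_dist p X \<mu> \<nu> \<le> ennpowr (ennreal (cost p X U g)) (1 / p)"
    unfolding wasserstein_dist_def using p by (intro ennpowr_mono) auto
  then show ?thesis using cost_nonneg[OF assms] by (simp add: ennpowr_ennreal)
qed

text \<open>Together with \<open>wasserstein_dist_le\<close> this makes the distance the infimum,
  over plans, of the p-th root of the cost. Couplings do not appear in any later argument.\<close>

lemma wasserstein_dist_ge:
  assumes "\<And>g. plan U (wt \<mu>) (wt \<nu>) g \<Longrightarrow> z \<le> ennreal (cost p X U g powr (1 / p))"
  shows "z \<le> wasserstein_dist p X \<mu> \<nu>"
proof -
  have "ennpowr z p \<le> (INF \<gamma>\<in>couplings X \<mu> \<nu>. \<integral>\<^sup>+ (x, y). ennreal (mdist X x y powr p) \<partial>\<gamma>)"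
  proof (rule INF_greatest)
    fix \<gamma> assume \<gamma>: "\<gamma> \<in> couplings X \<mu> \<nu>"
    have "z \<le> ennpowr (ennreal (cost p X U (\<lambda>x y. measure \<gamma> {(x, y)}))) (1 / p)"
      using assms[OF plan_of_coupling[OF \<gamma>]] cost_nonneg[OF plan_of_coupling[OF \<gamma>]]
      by (simp add: ennpowr_ennreal)
    then show "ennpowr z p \<le> (\<integral>\<^sup>+ (x, y). ennreal (mdist X x y powr p) \<partial>\<gamma>)"
      unfolding integral_coupling[OF \<gamma>] using p by (subst ennpowr_le_iff) auto
  qed
  then show ?thesis unfolding wasserstein_dist_def using p by (subst ennpowr_le_iff[symmetric]) auto
qed

text \<open>The bounds before the root is taken: at the level of p-th powers the cost is linear in
  the plan, which is what \<open>W_mix\<close> exploits.\<close>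

lemma wasserstein_dist_powr_le:
  assumes "plan U (wt \<mu>) (wt \<nu>) g"
  shows "ennpowr (wasserstein_dist p X \<mu> \<nu>) p \<le> ennreal (cost p X U g)"
  using wasserstein_dist_le[OF assms] p cost_nonneg[OF assms]
  by (subst ennpowr_le_iff) (auto simp: ennpowr_ennreal)

lemma wasserstein_dist_powr_ge:
  assumes "\<And>g. plan U (wt \<mu>) (wt \<nu>) g \<Longrightarrow> z \<le> ennreal (cost p X U g)"
  shows "z \<le> ennpowr (wasserstein_dist p X \<mu> \<nu>) p"
proof -
  have "ennpowr z (1 / p) \<le> wasserstein_dist p X \<mu> \<nu>"
  proof (rule wasserstein_dist_ge)
    fix g assume g: "plan U (wt \<mu>) (wt \<nu>) g"
    then have "ennpowr z (1 / p) \<le> ennpowr (ennreal (cost p X U g)) (1 / p)"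
      using assms p by (intro ennpowr_mono) auto
    then show "ennpowr z (1 / p) \<le> ennreal (cost p X U g powr (1 / p))"
      using cost_nonneg[OF g] by (simp add: ennpowr_ennreal)
  qed
  then show ?thesis using ennpowr_le_iff[of "1 / p" z] p by simp
qed

text \<open>The independent plan has finite cost. Finiteness is what makes an inequality "distance
  plus e is at most distance" contradictory in the two lemmas that follow.\<close>

lemma wasserstein_dist_finite: "wasserstein_dist p X \<mu> \<nu> < \<infinity>"
proof -
  have "plan U (wt \<mu>) (wt \<nu>) (\<lambda>x y. wt \<mu> x * wt \<nu> y)"
    using sum_weights[OF \<mu>(1) U(1) \<mu>(2)] sum_weights[OF \<nu>(1) U(1) \<nu>(2)]
    unfolding plan_def sum_distrib_left[symmetric] sum_distrib_right[symmetric] by simp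
  from wasserstein_dist_le[OF this] show ?thesis
    by (rule order.strict_trans1) simp
qed

text \<open>If every plan exceeded the distance by more than e, then distance plus e would be a
  lower bound for all plans, hence for the distance itself.\<close>

lemma near_optimal_plan:
  assumes "e > 0"
  shows "\<exists>g. plan U (wt \<mu>) (wt \<nu>) g \<and>
    ennreal (cost p X U g powr (1 / p)) \<le> wasserstein_dist p X \<mu> \<nu> + ennreal e"
proof (rule ccontr)
  assume "\<not> ?thesis"
  then have "wasserstein_dist p X \<mu> \<nu> + ennreal e \<le> wasserstein_dist p X \<mu> \<nu>"
    by (intro wasserstein_dist_ge) (meson nle_le)
  then show False using wasserstein_dist_finite assms
    by (cases "wasserstein_dist p X \<mu> \<nu>") (auto simp flip: ennreal_plus)
qed

lemma near_optimal_plan_powr: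
  assumes "e > 0"
  shows "\<exists>g. plan U (wt \<mu>) (wt \<nu>) g \<and>
    ennreal (cost p X U g) \<le> ennpowr (wasserstein_dist p X \<mu> \<nu>) p + ennreal e"
proof (rule ccontr)
  let ?W = "ennpowr (wasserstein_dist p X \<mu> \<nu>) p"
  assume "\<not> ?thesis"
  then have "?W + ennreal e \<le> ?W"
    by (intro wasserstein_dist_powr_ge) (meson nle_le)
  moreover have "?W < \<infinity>" using wasserstein_dist_finite by (auto simp: ennpowr_def)
  ultimately show False using assms
    by (cases ?W) (auto simp flip: ennreal_plus)
qed

end

end

section \<open>The Wasserstein algebra of finitely supported measures\<close>

text \<open>\<open>k\<close> is the joint law of a triple in which the two outer points are
  conditionally independent given the middle one. Its two-point marginals are \<open>g\<close> and
  \<open>h\<close>, so its marginal on the outer points transports \<open>m\<close> to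
  \<open>l\<close>.\<close>

lemma plan_glue:
  fixes X :: "'a metric" and g h :: "'a \<Rightarrow> 'a \<Rightarrow> real" and n :: "'a \<Rightarrow> real"
  defines "k \<equiv> \<lambda>x y z. g x y * h y z / n y"
  assumes p: "p \<ge> 1" and U: "finite U" "U \<subseteq> mspace X"
    and g: "plan U m n g" and h: "plan U n l h"
  shows "plan U m l (\<lambda>x z. \<Sum>y\<in>U. k x y z)"
    and "cost p X U (\<lambda>x z. \<Sum>y\<in>U. k x y z) powr (1 / p)
      \<le> cost p X U g powr (1 / p) + cost p X U h powr (1 / p)"
proof -
  have g0: "0 \<le> g x y" and h0: "0 \<le> h x y" if "x \<in> U" "y \<in> U" for x y
    using g h that by (auto simp: plan_def)
  have gn: "(\<Sum>x\<in>U. g x y) = n y" and hn: "(\<Sum>z\<in>U. h y z) = n y" if "y \<in> U" for y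
    using g h that by (auto simp: plan_def)
  have n0: "0 \<le> n y" if "y \<in> U" for y
    unfolding gn[OF that, symmetric] using that g0 by (intro sum_nonneg) auto
  have k0: "0 \<le> k x y z" if "x \<in> U" "y \<in> U" "z \<in> U" for x y z
    using g0 h0 n0 that by (simp add: k_def)
  \<comment> \<open>Where \<open>n y = 0\<close> the quotient in \<open>k\<close> is 0 by the
    convention for division. This agrees with the required marginals, since column y of
    \<open>g\<close> and row y of \<open>h\<close> are nonnegative with sum 0.\<close>
  have vanish: "g x y = 0" "h y x = 0" if "n y = 0" "x \<in> U" "y \<in> U" for x y
  proof -
    show "g x y = 0"
      using gn[OF that(3)] that U(1) g0 by (simp add: sum_nonneg_eq_0_iff)
    show "h y x = 0"
      using hn[OF that(3)] that U(1) h0 by (simp add: sum_nonneg_eq_0_iff)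
  qed
  have kz: "(\<Sum>z\<in>U. k x y z) = g x y" if "x \<in> U" "y \<in> U" for x y
  proof -
    have "(\<Sum>z\<in>U. k x y z) = g x y * (\<Sum>z\<in>U. h y z) / n y"
      by (simp add: k_def sum_distrib_left sum_divide_distrib)
    then show ?thesis using hn that vanish by auto
  qed
  have kx: "(\<Sum>x\<in>U. k x y z) = h y z" if "z \<in> U" "y \<in> U" for y z
  proof -
    have "(\<Sum>x\<in>U. k x y z) = (\<Sum>x\<in>U. g x y) * h y z / n y"
      by (simp add: k_def sum_distrib_right sum_divide_distrib)
    then show ?thesis using gn that vanish by auto
  qed
  show "plan U m l (\<lambda>x z. \<Sum>y\<in>U. k x y z)"
    unfolding plan_def
  proof (intro conjI ballI)
    fix x assume x: "x \<in> U"
    show "(\<Sum>z\<in>U. \<Sum>y\<in>U. k x y z) = m x"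
      using x g kz by (subst sum.swap) (simp add: plan_def)
    show "(\<Sum>x'\<in>U. \<Sum>y\<in>U. k x' y x) = l x"
      using x h kx by (subst sum.swap) (simp add: plan_def)
    show "0 \<le> (\<Sum>y\<in>U. k x y z)" if "z \<in> U" for z
      using k0 x that by (intro sum_nonneg) auto
  qed
  \<comment> \<open>Over triples weighted by \<open>k\<close>, both costs are p-th powers of norms
    over one index set, where the metric triangle inequality holds pointwise and
    \<open>Minkowski_sum\<close> applies.\<close>
  let ?I = "U \<times> U \<times> U"
  let ?k = "\<lambda>(x, y, z). k x y z"
  let ?a = "\<lambda>(x, y, z). mdist X x y" and ?b = "\<lambda>(x, y, z). mdist X y z"
  have triple: "(\<Sum>i\<in>?I. ?k i * (case i of (x, y, z) \<Rightarrow> \<phi> x y z) powr p)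
      = (\<Sum>x\<in>U. \<Sum>y\<in>U. \<Sum>z\<in>U. k x y z * \<phi> x y z powr p)" for \<phi>
    unfolding sum.cartesian_product by (simp add: case_prod_beta)
  have a: "(\<Sum>i\<in>?I. ?k i * ?a i powr p) = cost p X U g"
    unfolding triple cost_def by (intro sum.cong refl) (simp add: kz flip: sum_distrib_right)
  have "(\<Sum>i\<in>?I. ?k i * ?b i powr p) = (\<Sum>y\<in>U. \<Sum>x\<in>U. \<Sum>z\<in>U. k x y z * mdist X y z powr p)"
    unfolding triple by (rule sum.swap)
  also have "\<dots> = (\<Sum>y\<in>U. \<Sum>z\<in>U. \<Sum>x\<in>U. k x y z * mdist X y z powr p)"
    by (intro sum.cong refl sum.swap)
  also have "\<dots> = cost p X U h"
    unfolding cost_def by (intro sum.cong refl) (simp add: kx flip: sum_distrib_right)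
  finally have b: "(\<Sum>i\<in>?I. ?k i * ?b i powr p) = cost p X U h" .
  have "cost p X U (\<lambda>x z. \<Sum>y\<in>U. k x y z)
      = (\<Sum>x\<in>U. \<Sum>z\<in>U. \<Sum>y\<in>U. k x y z * mdist X x z powr p)"
    by (simp add: cost_def sum_distrib_right)
  also have "\<dots> = (\<Sum>x\<in>U. \<Sum>y\<in>U. \<Sum>z\<in>U. k x y z * mdist X x z powr p)"
    by (intro sum.cong refl sum.swap)
  also have "\<dots> = (\<Sum>i\<in>?I. ?k i * (case i of (x, y, z) \<Rightarrow> mdist X x z) powr p)"
    unfolding triple ..
  also have "\<dots> \<le> (\<Sum>i\<in>?I. ?k i * (?a i + ?b i) powr p)"
    using k0 U(2) p by (intro sum_mono mult_left_mono powr_mono2) (auto intro!: mdist_triangle)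
  finally have "cost p X U (\<lambda>x z. \<Sum>y\<in>U. k x y z) powr (1 / p)
      \<le> (\<Sum>i\<in>?I. ?k i * (?a i + ?b i) powr p) powr (1 / p)"
    using p cost_nonneg[OF \<open>plan U m l _\<close>] by (intro powr_mono2) auto
  also have "\<dots> \<le> (\<Sum>i\<in>?I. ?k i * ?a i powr p) powr (1 / p) + (\<Sum>i\<in>?I. ?k i * ?b i powr p) powr (1 / p)"
    using U(1) k0 p by (intro Minkowski_sum) auto
  finally show "cost p X U (\<lambda>x z. \<Sum>y\<in>U. k x y z) powr (1 / p)
      \<le> cost p X U g powr (1 / p) + cost p X U h powr (1 / p)"
    unfolding a b .
qed

context
  fixes X :: "'a metric" and p :: real
  assumes p: "p \<ge> 1"
begin

private abbreviation (input) W :: "'a measure \<Rightarrow> 'a measure \<Rightarrow> ennreal"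
  where "W \<equiv> wasserstein_dist p X"

lemma W_commute:
  assumes "\<mu> \<in> fin_prob X" "\<nu> \<in> fin_prob X"
  shows "W \<mu> \<nu> = W \<nu> \<mu>"
proof -
  have le: "W \<nu> \<mu> \<le> W \<mu> \<nu>" if "\<mu> \<in> fin_prob X" "\<nu> \<in> fin_prob X" for \<mu> \<nu>
  proof -
    define U where "U = atoms \<mu> \<union> atoms \<nu>"
    have U: "finite U" "U \<subseteq> mspace X" "atoms \<mu> \<subseteq> U" "atoms \<nu> \<subseteq> U"
      using finite_atoms(1,2)[OF that(1)] finite_atoms(1,2)[OF that(2)] by (auto simp: U_def)
    show ?thesis
    proof (rule wasserstein_dist_ge[OF U(1,2) that(1) U(3) that(2) U(4) p])
      fix g assume "plan U (wt \<mu>) (wt \<nu>) g"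
      from wasserstein_dist_le[OF U(1,2) that(2) U(4) that(1) U(3) p plan_flip[OF this]]
      show "W \<nu> \<mu> \<le> ennreal (cost p X U g powr (1 / p))" by (simp only: cost_flip[of p X U g])
    qed
  qed
  from le[OF assms] le[OF assms(2,1)] show ?thesis by (rule antisym[rotated])
qed

lemma W_triangle:
  assumes "\<mu> \<in> fin_prob X" "\<nu> \<in> fin_prob X" "\<rho> \<in> fin_prob X"
  shows "W \<mu> \<rho> \<le> W \<mu> \<nu> + W \<nu> \<rho>"
proof -
  define U where "U = atoms \<mu> \<union> atoms \<nu> \<union> atoms \<rho>"
  have U: "finite U" "U \<subseteq> mspace X" "atoms \<mu> \<subseteq> U" "atoms \<nu> \<subseteq> U" "atoms \<rho> \<subseteq> U"
    using finite_atoms(1,2)[OF assms(1)] finite_atoms(1,2)[OF assms(2)] finite_atoms(1,2)[OF assms(3)]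
    by (auto simp: U_def)
  show ?thesis
  proof (rule ennreal_le_epsilon)
    fix e :: real assume "0 < e"
    then have e: "0 < e / 2" by simp
    obtain g where g: "plan U (wt \<mu>) (wt \<nu>) g"
      "ennreal (cost p X U g powr (1 / p)) \<le> W \<mu> \<nu> + ennreal (e / 2)"
      using near_optimal_plan[OF U(1,2) assms(1) U(3) assms(2) U(4) p e] by blast
    obtain h where h: "plan U (wt \<nu>) (wt \<rho>) h"
      "ennreal (cost p X U h powr (1 / p)) \<le> W \<nu> \<rho> + ennreal (e / 2)"
      using near_optimal_plan[OF U(1,2) assms(2) U(4) assms(3) U(5) p e] by blast
    note glue = plan_glue[OF p U(1,2) g(1) h(1)]
    have "W \<mu> \<rho> \<le> ennreal (cost p X U g powr (1 / p) + cost p X U h powr (1 / p))"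
      using wasserstein_dist_le[OF U(1,2) assms(1) U(3) assms(3) U(5) p glue(1)] ennreal_leI[OF glue(2)]
      by (rule order.trans)
    also have "\<dots> \<le> (W \<mu> \<nu> + ennreal (e / 2)) + (W \<nu> \<rho> + ennreal (e / 2))"
      using g(2) h(2) by (simp add: add_mono)
    also have "\<dots> = W \<mu> \<nu> + W \<nu> \<rho> + (ennreal (e / 2) + ennreal (e / 2))" by (simp add: ac_simps)
    also have "ennreal (e / 2) + ennreal (e / 2) = ennreal e"
      using e by (subst ennreal_plus[symmetric]) auto
    finally show "W \<mu> \<rho> \<le> W \<mu> \<nu> + W \<nu> \<rho> + ennreal e" .
  qed
qed

text \<open>A plan moves at least \<open>\<mu>{z} - \<nu>{z}\<close> of mass away from \<open>z\<close>, to points of a finite set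
  and hence over a distance bounded from below.\<close>

lemma W_0_imp_weight_le:
  assumes "\<mu> \<in> fin_prob X" "\<nu> \<in> fin_prob X" "W \<mu> \<nu> = 0"
  shows "wt \<mu> z \<le> wt \<nu> z"
proof (cases "z \<in> atoms \<mu>")
  case z: True
  define U where "U = atoms \<mu> \<union> atoms \<nu>"
  have U: "finite U" "U \<subseteq> mspace X" "atoms \<mu> \<subseteq> U" "atoms \<nu> \<subseteq> U"
    using finite_atoms(1,2)[OF assms(1)] finite_atoms(1,2)[OF assms(2)] by (auto simp: U_def)
  have zU: "z \<in> U" using z by (simp add: U_def)
  \<comment> \<open>The element 1 keeps \<open>D\<close> nonempty when \<open>U\<close> is just {z},
    so that its minimum is a positive number in every case.\<close>
  define D where "D = insert 1 ((\<lambda>y. mdist X z y powr p) ` (U - {z}))"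
  define \<delta> where "\<delta> = Min D"
  have D: "finite D" "D \<noteq> {}" using U(1) by (auto simp: D_def)
  have "0 < mdist X z y" if "y \<in> U - {z}" for y
    using that zU U(2) Metric_space.mdist_pos_less[OF Metric_space_mspace_mdist, of z y X] by auto
  then have "0 < d" if "d \<in> D" for d using that by (force simp: D_def)
  then have \<delta>: "0 < \<delta>" using D by (simp add: \<delta>_def)
  have \<delta>_le: "\<delta> \<le> mdist X z y powr p" if "y \<in> U - {z}" for y
    unfolding \<delta>_def using D that by (intro Min_le) (auto simp: D_def)
  have "ennreal (\<delta> * (wt \<mu> z - wt \<nu> z)) \<le> ennpowr (W \<mu> \<nu>) p"
  proof (rule wasserstein_dist_powr_ge[OF U(1,2) assms(1) U(3) assms(2) U(4) p], rule ennreal_leI)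
    fix g assume g: "plan U (wt \<mu>) (wt \<nu>) g"
    have g0: "0 \<le> g x y" if "x \<in> U" "y \<in> U" for x y using g that by (auto simp: plan_def)
    \<comment> \<open>Column z caps the mass that stays at z by the weight of z under
      \<open>\<nu>\<close>. The rest of row z has to leave z.\<close>
    have "g z z \<le> (\<Sum>x\<in>U. g x z)" using zU U(1) g0 by (intro member_le_sum) auto
    then have "g z z \<le> wt \<nu> z" using g zU by (simp add: plan_def)
    moreover have "wt \<mu> z = g z z + (\<Sum>y\<in>U - {z}. g z y)"
      using g zU U(1) by (simp add: plan_def sum.remove[symmetric])
    ultimately have "\<delta> * (wt \<mu> z - wt \<nu> z) \<le> \<delta> * (\<Sum>y\<in>U - {z}. g z y)"
      using \<delta> by (intro mult_left_mono) auto
    also have "\<dots> = (\<Sum>y\<in>U - {z}. g z y * \<delta>)" by (simp add: sum_distrib_left mult.commute)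
    also have "\<dots> \<le> (\<Sum>y\<in>U - {z}. g z y * mdist X z y powr p)"
      using \<delta>_le g0 zU by (intro sum_mono mult_left_mono) auto
    also have "\<dots> \<le> (\<Sum>y\<in>U. g z y * mdist X z y powr p)"
      using U(1) g0 zU by (intro sum_mono2) auto
    also have "\<dots> \<le> cost p X U g"
      unfolding cost_def using U(1) zU g0
      by (intro member_le_sum[where f = "\<lambda>x. \<Sum>y\<in>U. g x y * mdist X x y powr p"] sum_nonneg) auto
    finally show "\<delta> * (wt \<mu> z - wt \<nu> z) \<le> cost p X U g" .
  qed
  then have "\<delta> * (wt \<mu> z - wt \<nu> z) \<le> 0" using assms(3) by (simp add: ennreal_eq_0_iff)
  then show ?thesis using \<delta> by (simp add: mult_le_0_iff)
qed (simp add: atoms_def)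

text \<open>Equal measures are joined by the diagonal plan, which moves nothing. Conversely,
  distance 0 bounds the weights of each measure by those of the other.\<close>

lemma W_eq_0_iff:
  assumes "\<mu> \<in> fin_prob X" "\<nu> \<in> fin_prob X"
  shows "W \<mu> \<nu> = 0 \<longleftrightarrow> \<mu> = \<nu>"
proof
  assume 0: "W \<mu> \<nu> = 0"
  then have "W \<nu> \<mu> = 0" using W_commute[OF assms] by simp
  then show "\<mu> = \<nu>"
    using W_0_imp_weight_le[OF assms 0] W_0_imp_weight_le[OF assms(2,1)]
    by (intro fin_prob_eqI[OF assms]) (auto intro: antisym)
next
  assume "\<mu> = \<nu>"
  note U = finite_atoms(1,2)[OF assms(1)] assms(1) subset_refl assms(1) subset_refl
  have "plan (atoms \<mu>) (wt \<mu>) (wt \<mu>) (\<lambda>x y. if x = y then wt \<mu> x else 0)"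
    using U(1) by (auto simp: plan_def)
  from wasserstein_dist_le[OF U p this]
  have "W \<mu> \<mu> \<le> ennreal (cost p X (atoms \<mu>) (\<lambda>x y. if x = y then wt \<mu> x else 0) powr (1 / p))" .
  also have "cost p X (atoms \<mu>) (\<lambda>x y. if x = y then wt \<mu> x else 0) = 0"
    unfolding cost_def using U(2) by (intro sum.neutral ballI) auto
  finally show "W \<mu> \<nu> = 0" using \<open>\<mu> = \<nu>\<close> by simp
qed

lemma W_mix:
  assumes r: "r \<in> {0..1}"
    and mem: "\<mu> \<in> fin_prob X" "\<mu>' \<in> fin_prob X" "\<nu> \<in> fin_prob X" "\<nu>' \<in> fin_prob X"
  shows "ennpowr (W (mix r \<mu> \<nu>) (mix r \<mu>' \<nu>')) p
    \<le> ennreal r * ennpowr (W \<mu> \<mu>') p + ennreal (1 - r) * ennpowr (W \<nu> \<nu>') p"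
proof -
  define U where "U = atoms \<mu> \<union> atoms \<mu>' \<union> atoms \<nu> \<union> atoms \<nu>'"
  have U: "finite U" "U \<subseteq> mspace X"
    and at: "atoms \<mu> \<subseteq> U" "atoms \<mu>' \<subseteq> U" "atoms \<nu> \<subseteq> U" "atoms \<nu>' \<subseteq> U"
    using finite_atoms(1,2)[OF mem(1)] finite_atoms(1,2)[OF mem(2)] finite_atoms(1,2)[OF mem(3)]
      finite_atoms(1,2)[OF mem(4)] by (auto simp: U_def)
  note mix = mix_fin_prob[OF mem(1,3) r] mix_fin_prob[OF mem(2,4) r]
  have at_mix: "atoms (mix r \<mu> \<nu>) \<subseteq> U" "atoms (mix r \<mu>' \<nu>') \<subseteq> U"
    by (auto simp: U_def atoms_def mix)
  show ?thesis
  proof (rule ennreal_le_epsilon)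
    fix e :: real assume e: "0 < e"
    obtain g where g: "plan U (wt \<mu>) (wt \<mu>') g"
      "ennreal (cost p X U g) \<le> ennpowr (W \<mu> \<mu>') p + ennreal e"
      using near_optimal_plan_powr[OF U mem(1) at(1) mem(2) at(2) p e] by blast
    obtain h where h: "plan U (wt \<nu>) (wt \<nu>') h"
      "ennreal (cost p X U h) \<le> ennpowr (W \<nu> \<nu>') p + ennreal e"
      using near_optimal_plan_powr[OF U mem(3) at(3) mem(4) at(4) p e] by blast
    define k where "k x y = r * g x y + (1 - r) * h x y" for x y
    have "plan U (wt (mix r \<mu> \<nu>)) (wt (mix r \<mu>' \<nu>')) k"
      using g(1) h(1) r by (auto simp: plan_def k_def mix sum.distrib simp flip: sum_distrib_left)
    from wasserstein_dist_powr_le[OF U mix(1) at_mix(1) mix(3) at_mix(2) p this]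
    have "ennpowr (W (mix r \<mu> \<nu>) (mix r \<mu>' \<nu>')) p \<le> ennreal (cost p X U k)" .
    also have "cost p X U k = r * cost p X U g + (1 - r) * cost p X U h"
      by (simp add: cost_def k_def sum_distrib_left distrib_right sum.distrib mult.assoc)
    also have "ennreal \<dots> = ennreal r * ennreal (cost p X U g) + ennreal (1 - r) * ennreal (cost p X U h)"
      using r cost_nonneg[OF g(1)] cost_nonneg[OF h(1)] by (simp add: ennreal_mult)
    also have "\<dots> \<le> ennreal r * (ennpowr (W \<mu> \<mu>') p + ennreal e)
        + ennreal (1 - r) * (ennpowr (W \<nu> \<nu>') p + ennreal e)"
      using g(2) h(2) by (intro add_mono mult_left_mono) auto
    \<comment> \<open>The two slacks combine with coefficients r and 1 - r, which sum to 1, so e is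
      lost only once.\<close>
    also have "\<dots> = ennreal r * ennpowr (W \<mu> \<mu>') p + ennreal (1 - r) * ennpowr (W \<nu> \<nu>') p
        + (ennreal r + ennreal (1 - r)) * ennreal e"
      by (simp add: distrib_left distrib_right ac_simps)
    also have "ennreal r + ennreal (1 - r) = 1"
      using r by (subst ennreal_plus[symmetric]) auto
    finally show "ennpowr (W (mix r \<mu> \<nu>) (mix r \<mu>' \<nu>')) p
      \<le> ennreal r * ennpowr (W \<mu> \<mu>') p + ennreal (1 - r) * ennpowr (W \<nu> \<nu>') p + ennreal e" by simp
  qed
qed

lemma wasserstein_algebra_fin_prob: "wasserstein_algebra p (fin_prob X) W mix"
proof (intro wasserstein_algebra.intro extended_metric_space.intro barycentric_algebra_fin_prob
    wasserstein_algebra_axioms.intro)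
  fix r :: real assume r: "r \<in> {0..1}"
  show "nonexpansive (fin_prob X \<times> fin_prob X) (\<lambda>(x, y) (x', y'). max (W x x') (W y y'))
      (fin_prob X) W (\<lambda>(x, y). mix r x y)"
    unfolding nonexpansive_def
  proof (intro conjI ballI)
    show "(\<lambda>(x, y). mix r x y) \<in> fin_prob X \<times> fin_prob X \<rightarrow> fin_prob X"
      using r by (auto intro: mix_fin_prob(1))
    fix a b assume "a \<in> fin_prob X \<times> fin_prob X" "b \<in> fin_prob X \<times> fin_prob X"
    then obtain x y x' y' where ab: "a = (x, y)" "b = (x', y')" "x \<in> fin_prob X" "y \<in> fin_prob X"
      "x' \<in> fin_prob X" "y' \<in> fin_prob X" by auto
    \<comment> \<open>Nonexpansiveness follows from \<open>W_mix\<close>: once both distances are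
      replaced by their maximum, the convex combination of p-th powers collapses to the p-th power
      of \<open>M\<close>.\<close>
    define M where "M = max (W x x') (W y y')"
    have "ennpowr (W (mix r x y) (mix r x' y')) p
        \<le> ennreal r * ennpowr (W x x') p + ennreal (1 - r) * ennpowr (W y y') p"
      using W_mix r ab by blast
    also have "\<dots> \<le> ennreal r * ennpowr M p + ennreal (1 - r) * ennpowr M p"
      using p by (intro add_mono mult_left_mono ennpowr_mono) (auto simp: M_def)
    also have "\<dots> = (ennreal r + ennreal (1 - r)) * ennpowr M p" by (simp add: distrib_right)
    also have "ennreal r + ennreal (1 - r) = 1"
      using r by (subst ennreal_plus[symmetric]) auto
    finally have "W (mix r x y) (mix r x' y') \<le> M"
      using p ennpowr_ennpowr[of p M] by (simp add: ennpowr_le_iff)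
    then show "W (case a of (x, y) \<Rightarrow> mix r x y) (case b of (x, y) \<Rightarrow> mix r x y)
        \<le> (case a of (x, y) \<Rightarrow> \<lambda>(x', y'). max (W x x') (W y y')) b"
      by (simp add: ab M_def)
  qed
qed (fact W_eq_0_iff W_commute W_triangle W_mix)+

lemma atoms_dirac:
  assumes "x \<in> mspace X"
  shows "atoms (dirac X x) \<subseteq> {x}"
proof
  fix y assume y: "y \<in> atoms (dirac X x)"
  then have "y \<in> mspace X" using finite_atoms(2)[OF dirac_fin_prob[OF assms]] by auto
  then show "y \<in> {x}" using y measure_dirac[OF assms] by (auto simp: atoms_def split: if_splits)
qed

lemma nonexpansive_dirac:
  "nonexpansive (mspace X) (\<lambda>x y. ennreal (mdist X x y)) (fin_prob X) W (dirac X)"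
  unfolding nonexpansive_def
proof (intro conjI ballI)
  fix x y assume xy: "x \<in> mspace X" "y \<in> mspace X"
  have U: "finite {x, y}" "{x, y} \<subseteq> mspace X" "dirac X x \<in> fin_prob X" "atoms (dirac X x) \<subseteq> {x, y}"
    "dirac X y \<in> fin_prob X" "atoms (dirac X y) \<subseteq> {x, y}"
    using xy atoms_dirac[of x] atoms_dirac[of y] dirac_fin_prob by auto
  \<comment> \<open>All mass travels from x to y. The case x = y is split off below because the
    index set then has only one point.\<close>
  define g where "g u v = (if u = x \<and> v = y then 1 else 0 :: real)" for u v
  have "plan {x, y} (wt (dirac X x)) (wt (dirac X y)) g"
    using xy by (cases "x = y") (auto simp: plan_def g_def measure_dirac)
  from wasserstein_dist_le[OF U p this]
  have "W (dirac X x) (dirac X y) \<le> ennreal (cost p X {x, y} g powr (1 / p))" .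
  also have "cost p X {x, y} g = mdist X x y powr p"
    using xy by (cases "x = y") (auto simp: cost_def g_def)
  finally show "W (dirac X x) (dirac X y) \<le> ennreal (mdist X x y)"
    using p by (simp add: powr_powr)
qed (use dirac_fin_prob in auto)

end

section \<open>Convex combinations in a barycentric algebra\<close>

text \<open>A barycentric algebra sits at height one of its cone, whose nonzero elements are the
  pairs of a positive mass and a point, with the barycentre as point of a sum. Commutativity and
  associativity of this addition are exactly skew commutativity and skew associativity, so finite
  convex combinations do not depend on the order of their terms.\<close>

context barycentric_algebra
begin

text \<open>\<open>None\<close> is the apex, of mass 0, and carries no point. All other masses are
  positive, so \<open>r / (r + s)\<close> is a genuine proportion strictly between 0 and 1. The
  monoid record gives access to \<open>finprod\<close> for finite sums.\<close>

definition cone :: "(real \<times> 'a) option monoid"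
  where "cone = \<lparr>carrier = insert None (Some ` ({0<..} \<times> A)),
    monoid.mult = (\<lambda>u v. case u of None \<Rightarrow> v | Some (r, a) \<Rightarrow>
      (case v of None \<Rightarrow> u | Some (s, b) \<Rightarrow> Some (r + s, bary (r / (r + s)) a b))),
    one = None\<rparr>"

lemma cone_simps [simp]:
  "None \<otimes>\<^bsub>cone\<^esub> v = v"
  "u \<otimes>\<^bsub>cone\<^esub> None = u"
  "Some (r, a) \<otimes>\<^bsub>cone\<^esub> Some (s, b) = Some (r + s, bary (r / (r + s)) a b)"
  "\<one>\<^bsub>cone\<^esub> = None"
  by (auto simp: cone_def split: option.splits)

lemma carrier_cone: "carrier cone = insert None (Some ` ({0<..} \<times> A))"
  by (simp add: cone_def)

lemma comm_monoid_cone: "comm_monoid cone"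
proof (rule comm_monoidI)
  fix u v w assume u: "u \<in> carrier cone" and v: "v \<in> carrier cone"
  then show "u \<otimes>\<^bsub>cone\<^esub> v \<in> carrier cone"
    by (auto simp: carrier_cone intro!: closed add_pos_pos)
  show "u \<otimes>\<^bsub>cone\<^esub> v = v \<otimes>\<^bsub>cone\<^esub> u"
  proof -
    have "bary (r / (r + s)) a b = bary (s / (s + r)) b a"
      if "0 < r" "0 < s" "a \<in> A" "b \<in> A" for r s a b
    proof -
      have "1 - r / (r + s) = s / (s + r)" using that by (simp add: field_simps)
      then show ?thesis using that skew_commute[of "r / (r + s)" a b] by simp
    qed
    then show ?thesis using u v by (auto simp: carrier_cone add.commute)
  qed
  assume w: "w \<in> carrier cone"
  have "bary ((r + s) / (r + s + t)) (bary (r / (r + s)) a b) c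
      = bary (r / (r + (s + t))) a (bary (s / (s + t)) b c)"
    if "0 < r" "0 < s" "0 < t" "a \<in> A" "b \<in> A" "c \<in> A" for r s t a b c
  proof -
    \<comment> \<open>\<open>R\<close> is the share of the first two masses in the total, and
      \<open>Q\<close> that of the first within the first two. Positive masses keep both below 1, as
      \<open>skew_assoc\<close> requires, and its inner parameter turns out to be the share of the
      second mass within the last two.\<close>
    define R where "R = (r + s) / (r + s + t)"
    define Q where "Q = r / (r + s)"
    have RQ: "R \<in> {0..<1}" "Q \<in> {0..<1}" using that by (auto simp: R_def Q_def)
    have QR: "Q * R = r / (r + (s + t))"
      using that by (simp add: R_def Q_def add.assoc)
    have "R - Q * R = s / (r + (s + t))" unfolding QR using that
      by (simp add: R_def add.assoc flip: diff_divide_distrib)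
    moreover have "1 - Q * R = (s + t) / (r + (s + t))"
      unfolding QR using that by (simp add: field_simps)
    ultimately have "(R - Q * R) / (1 - Q * R) = s / (s + t)"
      using that by simp
    then show ?thesis
      using skew_assoc[OF RQ(2,1) that(4-6)] QR by (simp add: R_def Q_def)
  qed
  then show "u \<otimes>\<^bsub>cone\<^esub> v \<otimes>\<^bsub>cone\<^esub> w = u \<otimes>\<^bsub>cone\<^esub> (v \<otimes>\<^bsub>cone\<^esub> w)"
    using u v w by (auto simp: carrier_cone add.assoc)
qed (simp_all add: carrier_cone)

section \<open>Finite sums in the cone and their barycentres\<close>

sublocale cone: comm_monoid cone
  by (rule comm_monoid_cone)

text \<open>Weight 0 goes to the neutral element, so points of weight 0 disappear from sums and
  index sets may be enlarged freely.\<close>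

definition weighted :: "real \<Rightarrow> 'a \<Rightarrow> (real \<times> 'a) option"
  where "weighted w a = (if w = 0 then None else Some (w, a))"

lemma weighted_closed [simp]: "0 \<le> w \<Longrightarrow> a \<in> A \<Longrightarrow> weighted w a \<in> carrier cone"
  by (auto simp: weighted_def carrier_cone)

text \<open>This is idempotence: adding two multiples of one point keeps the point.\<close>

lemma weighted_add:
  "0 \<le> v \<Longrightarrow> 0 \<le> w \<Longrightarrow> a \<in> A \<Longrightarrow> weighted (v + w) a = weighted v a \<otimes>\<^bsub>cone\<^esub> weighted w a"
  by (auto simp: weighted_def idem)

definition cone_sum :: "'i set \<Rightarrow> ('i \<Rightarrow> real) \<Rightarrow> ('i \<Rightarrow> 'a) \<Rightarrow> (real \<times> 'a) option"
  where "cone_sum I w a = finprod cone (\<lambda>i. weighted (w i) (a i)) I"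

text \<open>The barycentre is a junk value unless the total weight is positive.\<close>

definition barycentre :: "'i set \<Rightarrow> ('i \<Rightarrow> real) \<Rightarrow> ('i \<Rightarrow> 'a) \<Rightarrow> 'a"
  where "barycentre I w a = snd (the (cone_sum I w a))"

lemma cone_sum_insert:
  assumes "finite I" "i \<notin> I" "\<And>j. j \<in> insert i I \<Longrightarrow> 0 \<le> w j" "\<And>j. j \<in> insert i I \<Longrightarrow> a j \<in> A"
  shows "cone_sum (insert i I) w a = weighted (w i) (a i) \<otimes>\<^bsub>cone\<^esub> cone_sum I w a"
  unfolding cone_sum_def using assms by (intro cone.finprod_insert) auto

lemma cone_sum_cong:
  assumes "\<And>i. i \<in> I \<Longrightarrow> 0 \<le> w i" "\<And>i. i \<in> I \<Longrightarrow> a i \<in> A" "\<And>i. i \<in> I \<Longrightarrow> w i = v i"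
    "\<And>i. i \<in> I \<Longrightarrow> a i = b i"
  shows "cone_sum I w a = cone_sum I v b"
  unfolding cone_sum_def using assms by (intro cone.finprod_cong') auto

lemma cone_sum_mono_neutral:
  assumes "finite J" "I \<subseteq> J" "\<And>i. i \<in> J \<Longrightarrow> 0 \<le> w i" "\<And>i. i \<in> J \<Longrightarrow> a i \<in> A"
    "\<And>i. i \<in> J - I \<Longrightarrow> w i = 0"
  shows "cone_sum I w a = cone_sum J w a"
  unfolding cone_sum_def using assms
  by (intro cone.finprod_mono_neutral_cong_left) (auto simp: weighted_def[of 0])

text \<open>The mass component of a cone sum is the total weight. The zero case is carried along
  because a partial sum may still be at the apex.\<close>

lemma cone_sum_cases:
  assumes "finite I" "\<And>i. i \<in> I \<Longrightarrow> 0 \<le> w i" "\<And>i. i \<in> I \<Longrightarrow> a i \<in> A"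
  shows "(sum w I = 0 \<longrightarrow> cone_sum I w a = None) \<and>
    (0 < sum w I \<longrightarrow> (\<exists>c\<in>A. cone_sum I w a = Some (sum w I, c)))"
  using assms
proof (induction I)
  case empty
  then show ?case by (simp add: cone_sum_def)
next
  case (insert i I)
  note ins = cone_sum_insert[of I i w a, OF insert.hyps insert.prems]
  have nn: "0 \<le> w i" "0 \<le> sum w I" using insert.prems by (auto intro: sum_nonneg)
  consider "sum w I = 0" | "0 < sum w I" using nn by linarith
  then show ?case
  proof cases
    case 1
    then show ?thesis using insert ins nn by (auto simp: weighted_def)
  next
    case 2
    then obtain c where "c \<in> A" "cone_sum I w a = Some (sum w I, c)" using insert by auto
    then have "\<exists>c\<in>A. cone_sum (insert i I) w a = Some (sum w (insert i I), c)"
      using 2 ins nn insert.hyps insert.prems(2)[of i]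
      by (cases "w i = 0") (auto simp: weighted_def intro!: closed)
    moreover have "0 < sum w (insert i I)" using 2 nn insert.hyps by simp
    ultimately show ?thesis by (auto simp del: sum.insert)
  qed
qed

lemma barycentre:
  assumes "finite I" "\<And>i. i \<in> I \<Longrightarrow> 0 \<le> w i" "\<And>i. i \<in> I \<Longrightarrow> a i \<in> A" "0 < sum w I"
  shows "barycentre I w a \<in> A" "cone_sum I w a = Some (sum w I, barycentre I w a)"
  using cone_sum_cases[of I w a, OF assms(1-3)] assms(4) by (auto simp: barycentre_def)

text \<open>Terms with the same image under \<open>\<pi>\<close> are merged. In the induction, a new
  index changes the weight of the single point \<open>\<pi> i\<close>, by \<open>w i\<close>.
  Applied to the two projections of \<open>U \<times> U\<close>, it rewrites barycentres over a plan
  as barycentres over its marginals.\<close>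

lemma cone_sum_pushforward:
  assumes "finite I" "finite J" "\<pi> \<in> I \<rightarrow> J" "\<And>j. j \<in> J \<Longrightarrow> b j \<in> A" "\<And>i. i \<in> I \<Longrightarrow> 0 \<le> w i"
  shows "cone_sum I w (\<lambda>i. b (\<pi> i)) = cone_sum J (\<lambda>j. \<Sum>i | i \<in> I \<and> \<pi> i = j. w i) b"
  using assms(1,3,5)
proof (induction I)
  case empty
  show ?case by (simp add: cone_sum_def weighted_def cone.finprod_one_eqI)
next
  case (insert i I)
  have split: "(\<Sum>i' | i' \<in> insert i I \<and> \<pi> i' = j. w i')
      = (if \<pi> i = j then w i else 0) + (\<Sum>i' | i' \<in> I \<and> \<pi> i' = j. w i')" for j
  proof -
    have "{i'. i' \<in> insert i I \<and> \<pi> i' = j}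
        = (if \<pi> i = j then insert i {i'. i' \<in> I \<and> \<pi> i' = j} else {i'. i' \<in> I \<and> \<pi> i' = j})" by auto
    then show ?thesis using insert.hyps by simp
  qed
  have nn: "0 \<le> (\<Sum>i' | i' \<in> I \<and> \<pi> i' = j. w i')" for j
    using insert.prems by (intro sum_nonneg) auto
  have wi: "0 \<le> w i" "\<pi> i \<in> J" using insert.prems by auto
  have "cone_sum J (\<lambda>j. \<Sum>i' | i' \<in> insert i I \<and> \<pi> i' = j. w i') b
      = finprod cone (\<lambda>j. weighted (if \<pi> i = j then w i else 0) (b j)
          \<otimes>\<^bsub>cone\<^esub> weighted (\<Sum>i' | i' \<in> I \<and> \<pi> i' = j. w i') (b j)) J"
    unfolding cone_sum_def split using nn wi assms(4)
    by (intro cone.finprod_cong') (auto simp: weighted_add)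
  also have "\<dots> = finprod cone (\<lambda>j. weighted (if \<pi> i = j then w i else 0) (b j)) J
      \<otimes>\<^bsub>cone\<^esub> cone_sum J (\<lambda>j. \<Sum>i' | i' \<in> I \<and> \<pi> i' = j. w i') b"
    unfolding cone_sum_def using nn wi assms(4) by (intro cone.finprod_multf) auto
  also have "finprod cone (\<lambda>j. weighted (if \<pi> i = j then w i else 0) (b j)) J
      = finprod cone (\<lambda>j. if \<pi> i = j then weighted (w i) (b j) else \<one>\<^bsub>cone\<^esub>) J"
    using wi assms(4) by (intro cone.finprod_cong') (auto simp: weighted_def carrier_cone)
  also have "\<dots> = weighted (w i) (b (\<pi> i))"
    using wi assms(2,4) by (intro cone.finprod_singleton) auto
  also have "cone_sum J (\<lambda>j. \<Sum>i' | i' \<in> I \<and> \<pi> i' = j. w i') b = cone_sum I w (\<lambda>i. b (\<pi> i))"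
    using insert by auto
  finally show ?case
    using insert assms(4) by (subst cone_sum_insert) auto
qed

text \<open>Scaling all masses by a positive factor leaves the proportions
  \<open>r / (r + s)\<close> unchanged, hence also the points.\<close>

lemma cone_sum_scale:
  assumes "finite I" "\<And>i. i \<in> I \<Longrightarrow> 0 \<le> w i" "\<And>i. i \<in> I \<Longrightarrow> a i \<in> A" "0 < k"
  shows "cone_sum I (\<lambda>i. k * w i) a = map_option (\<lambda>(r, c). (k * r, c)) (cone_sum I w a)"
  using assms(1-3)
proof (induction I)
  case empty
  then show ?case by (simp add: cone_sum_def)
next
  case (insert i I)
  have "k * r / (k * r + k * s) = r / (r + s)" for r s
    using assms(4) by (simp flip: distrib_left)
  then have "map_option (\<lambda>(r, c). (k * r, c)) (u \<otimes>\<^bsub>cone\<^esub> v)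
      = map_option (\<lambda>(r, c). (k * r, c)) u \<otimes>\<^bsub>cone\<^esub> map_option (\<lambda>(r, c). (k * r, c)) v" for u v
    by (cases u; cases v) (auto simp: distrib_left)
  moreover have "weighted (k * w i) (a i) = map_option (\<lambda>(r, c). (k * r, c)) (weighted (w i) (a i))"
    using assms(4) by (simp add: weighted_def)
  ultimately show ?case
    using insert assms(4) cone_sum_insert[of I i w a] cone_sum_insert[of I i "\<lambda>i. k * w i" a] by simp
qed

text \<open>In the cone, the sum for the mixed weights splits into two sums of masses r and 1 - r.
  Adding these applies \<open>bary\<close> with parameter r / (r + (1 - r)) = r. This is what makes
  the extension affine.\<close>

lemma barycentre_mix:
  assumes "finite I" "\<And>i. i \<in> I \<Longrightarrow> 0 \<le> v i" "\<And>i. i \<in> I \<Longrightarrow> 0 \<le> w i" "\<And>i. i \<in> I \<Longrightarrow> a i \<in> A"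
    and "sum v I = 1" "sum w I = 1" "r \<in> {0..1}"
  shows "barycentre I (\<lambda>i. r * v i + (1 - r) * w i) a = bary r (barycentre I v a) (barycentre I w a)"
proof -
  have v: "barycentre I v a \<in> A" "cone_sum I v a = Some (1, barycentre I v a)"
    using barycentre[of I v a] assms by auto
  have w: "barycentre I w a \<in> A" "cone_sum I w a = Some (1, barycentre I w a)"
    using barycentre[of I w a] assms by auto
  \<comment> \<open>The ends are separate because \<open>cone_sum_scale\<close> needs a positive
    factor: scaling by 0 would leave a point with mass 0 in place of \<open>None\<close>.\<close>
  consider "r = 0" | "r = 1" | "0 < r" "r < 1" using assms(7) by fastforce
  then show ?thesis
  proof cases
    case 1
    then show ?thesis using v w skew_commute[of 0] one by simp
  next
    case 2
    then show ?thesis using v w one by simp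
  next
    case 3
    have "cone_sum I (\<lambda>i. r * v i + (1 - r) * w i) a
        = finprod cone (\<lambda>i. weighted (r * v i) (a i) \<otimes>\<^bsub>cone\<^esub> weighted ((1 - r) * w i) (a i)) I"
      unfolding cone_sum_def using assms 3
      by (intro cone.finprod_cong') (auto simp: weighted_add)
    also have "\<dots> = cone_sum I (\<lambda>i. r * v i) a \<otimes>\<^bsub>cone\<^esub> cone_sum I (\<lambda>i. (1 - r) * w i) a"
      unfolding cone_sum_def using assms 3 by (intro cone.finprod_multf) auto
    also have "\<dots> = Some (1, bary r (barycentre I v a) (barycentre I w a))"
      using 3 assms v(2) w(2) by (simp add: cone_sum_scale)
    finally show ?thesis by (simp add: barycentre_def)
  qed
qed

end

text \<open>Iterates the binary inequality by splitting off one term. The weights are not normalised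
  and the total weight multiplies the left side, so the induction hypothesis applies to the
  remaining terms without rescaling.\<close>

lemma (in wasserstein_algebra) barycentre_dist:
  assumes "finite I" "\<And>i. i \<in> I \<Longrightarrow> 0 \<le> w i" "\<And>i. i \<in> I \<Longrightarrow> a i \<in> A" "\<And>i. i \<in> I \<Longrightarrow> b i \<in> A"
    and "0 < sum w I"
  shows "ennreal (sum w I) * ennpowr (d (barycentre I w a) (barycentre I w b)) p
    \<le> (\<Sum>i\<in>I. ennreal (w i) * ennpowr (d (a i) (b i)) p)"
  using assms
proof (induction I)
  case (insert i I)
  note ins = cone_sum_insert[of I i w a, OF insert.hyps insert.prems(1,2)]
    cone_sum_insert[of I i w b, OF insert.hyps insert.prems(1,3)]
  have nn: "0 \<le> w i" "0 \<le> sum w I" using insert.prems by (auto intro: sum_nonneg)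
  let ?s = "sum w I"
  let ?R = "\<Sum>j\<in>I. ennreal (w j) * ennpowr (d (a j) (b j)) p"
  have wI: "0 \<le> w j" "a j \<in> A" "b j \<in> A" if "j \<in> I" for j using insert.prems that by auto
  consider "w i = 0" | "0 < w i" "?s = 0" | "0 < w i" "0 < ?s" using nn by linarith
  then show ?case
  proof cases
    case 1
    then show ?thesis using insert ins by (simp add: barycentre_def weighted_def)
  next
    case 2
    then have "cone_sum I w a = None" "cone_sum I w b = None"
      using cone_sum_cases[of I w a, OF insert.hyps(1) wI(1,2)] cone_sum_cases[of I w b, OF insert.hyps(1) wI(1,3)] by auto
    then have "barycentre (insert i I) w a = a i" "barycentre (insert i I) w b = b i"
      using ins 2 by (simp_all add: barycentre_def weighted_def)
    then show ?thesis using 2 insert.hyps by simp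
  next
    case 3
    note ba = barycentre[of I w a, OF insert.hyps(1) wI(1,2) 3(2)]
    note bb = barycentre[of I w b, OF insert.hyps(1) wI(1,3) 3(2)]
    \<comment> \<open>The share of the new term in the total mass, which is the parameter that
      addition in the cone produces. Multiplied by the total mass, r and 1 - r give back
      \<open>w i\<close> and the remaining weight.\<close>
    define r where "r = w i / (w i + ?s)"
    have r: "r \<in> {0..1}" "(w i + ?s) * r = w i" "(w i + ?s) * (1 - r) = ?s"
      using 3 by (auto simp: r_def field_simps)
    let ?x = "barycentre I w a" and ?y = "barycentre I w b"
    have eq: "barycentre (insert i I) w a = bary r (a i) ?x" "barycentre (insert i I) w b = bary r (b i) ?y"
      using ins 3 ba(2) bb(2) by (simp_all add: barycentre_def[of "insert i I"] weighted_def r_def)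
    have "ennreal (w i + ?s) * ennpowr (d (bary r (a i) ?x) (bary r (b i) ?y)) p
        \<le> ennreal (w i + ?s) * (ennreal r * ennpowr (d (a i) (b i)) p + ennreal (1 - r) * ennpowr (d ?x ?y) p)"
      using insert.prems ba(1) bb(1) r by (intro mult_left_mono wasserstein) auto
    also have "\<dots> = ennreal ((w i + ?s) * r) * ennpowr (d (a i) (b i)) p
        + ennreal ((w i + ?s) * (1 - r)) * ennpowr (d ?x ?y) p"
      using r(1) nn by (simp add: distrib_left ennreal_mult mult.assoc del: ennreal_plus)
    also have "\<dots> = ennreal (w i) * ennpowr (d (a i) (b i)) p + ennreal ?s * ennpowr (d ?x ?y) p"
      unfolding r(2,3) ..
    also have "\<dots> \<le> ennreal (w i) * ennpowr (d (a i) (b i)) p + ?R"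
      using insert.IH[OF wI] 3 by (intro add_left_mono) auto
    finally show ?thesis using eq insert.hyps by simp
  qed
qed simp

section \<open>The universal property\<close>

text \<open>A measure with weight r < 1 at x is the mixture, with parameter r, of the Dirac measure
  at x and the renormalised rest \<open>\<nu>\<close>, whose atoms lie in the smaller set. For r = 1
  there is no rest to renormalise and the measure is Dirac. An empty \<open>U\<close> is impossible
  because the weights sum to 1.\<close>

lemma affine_map_determined_by_dirac:
  assumes h: "affine_map (fin_prob X) mix bary h" and k: "affine_map (fin_prob X) mix bary k"
    and eq: "\<And>x. x \<in> mspace X \<Longrightarrow> h (dirac X x) = k (dirac X x)"
    and "\<mu> \<in> fin_prob X"
  shows "h \<mu> = k \<mu>"
proof -
  have "h \<mu> = k \<mu>" if "finite U" "U \<subseteq> mspace X" "\<mu> \<in> fin_prob X" "atoms \<mu> \<subseteq> U" for U \<mu>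
    using that
  proof (induction U arbitrary: \<mu>)
    case empty
    then show ?case using sum_weights[of \<mu> X "{}"] by simp
  next
    case (insert x U)
    define r where "r = wt \<mu> x"
    have total: "r + (\<Sum>y\<in>U. wt \<mu> y) = 1"
      using sum_weights[OF insert.prems(2) _ insert.prems(3)] insert.hyps by (simp add: r_def)
    have x: "x \<in> mspace X" and U: "U \<subseteq> mspace X" using insert.prems by auto
    have "0 \<le> (\<Sum>y\<in>U. wt \<mu> y)" by (simp add: sum_nonneg)
    then have r: "0 \<le> r" "r \<le> 1" using total by (auto simp: r_def)
    have outside: "wt \<mu> y = 0" if "y \<noteq> x" "y \<notin> U" for y
      using that insert.prems(3) by (auto simp: atoms_def)
    show ?case
    proof (cases "r = 1")
      case True
      then have "wt \<mu> y = 0" if "y \<in> U" for y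
        using total that insert.hyps(1) by (simp add: sum_nonneg_eq_0_iff)
      then have "wt \<mu> y = 0" if "x \<noteq> y" for y using outside that by (cases "y \<in> U") auto
      then have "\<mu> = dirac X x"
        using True x insert.prems(2)
        by (intro fin_prob_eqI[of _ X]) (auto simp: dirac_fin_prob measure_dirac r_def)
      then show ?thesis using eq x by simp
    next
      case False
      with r have r1: "r < 1" by simp
      define \<nu> where "\<nu> = discrete_measure (mtopology_of X) U (\<lambda>y. wt \<mu> y / (1 - r))"
      have nn: "0 \<le> wt \<mu> y / (1 - r)" for y using r1 by simp
      have "(\<Sum>y\<in>U. wt \<mu> y / (1 - r)) = 1"
        using total r1 by (simp flip: sum_divide_distrib)
      then have \<nu>: "\<nu> \<in> fin_prob X"
        unfolding \<nu>_def using nn insert.hyps(1) U by (intro discrete_measure_fin_prob)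
      have wt_\<nu>: "wt \<nu> y = (if y \<in> U then wt \<mu> y / (1 - r) else 0)" if "y \<in> mspace X" for y
        unfolding \<nu>_def using nn insert.hyps(1) U that by (intro measure_discrete_measure)
      have at: "atoms \<nu> \<subseteq> U"
        using wt_\<nu> finite_atoms(2)[OF \<nu>] by (auto simp: atoms_def split: if_splits)
      have r01: "r \<in> {0..1}" using r by auto
      note mix = mix_fin_prob[OF dirac_fin_prob[OF x] \<nu> r01]
      have "\<mu> = mix r (dirac X x) \<nu>"
      proof (rule fin_prob_eqI[OF insert.prems(2) mix(1)])
        fix y assume y: "y \<in> mspace X"
        show "wt \<mu> y = wt (mix r (dirac X x) \<nu>) y"
          using r1 outside[of y] insert.hyps(2) unfolding mix(2) measure_dirac[OF x y] wt_\<nu>[OF y]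
          by (auto simp: r_def)
      qed
      moreover have "h (mix r (dirac X x) \<nu>) = k (mix r (dirac X x) \<nu>)"
        using h k r01 dirac_fin_prob[OF x] \<nu> eq[OF x] insert.IH[OF U \<nu> at]
        by (simp add: affine_map_def)
      ultimately show ?thesis by simp
    qed
  qed
  from this[OF finite_atoms(1,2)[OF assms(4)] assms(4) subset_refl] show ?thesis .
qed

section \<open>The extension of a nonexpansive map\<close>

context wasserstein_algebra
begin

text \<open>The restriction makes the map extensional, since uniqueness is claimed among functions
  that are \<open>undefined\<close> outside \<open>fin_prob X\<close>.\<close>

definition extension :: "'x metric \<Rightarrow> ('x \<Rightarrow> 'a) \<Rightarrow> 'x measure \<Rightarrow> 'a"
  where "extension X f = restrict (\<lambda>\<mu>. barycentre (atoms \<mu>) (wt \<mu>) f) (fin_prob X)"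

context
  fixes X :: "'x metric" and f :: "'x \<Rightarrow> 'a"
  assumes p: "p \<ge> 1"
    and f: "nonexpansive (mspace X) (\<lambda>x y. ennreal (mdist X x y)) A d f"
begin

lemma f_closed: "x \<in> mspace X \<Longrightarrow> f x \<in> A"
  using f by (auto simp: nonexpansive_def)

text \<open>Enlarging the atoms by points of weight 0 does not move the barycentre, so the images of
  two measures can be compared over one set.\<close>

lemma extension_eq:
  assumes "\<mu> \<in> fin_prob X" "finite U" "U \<subseteq> mspace X" "atoms \<mu> \<subseteq> U"
  shows "extension X f \<mu> = barycentre U (wt \<mu>) f"
proof -
  have "cone_sum (atoms \<mu>) (wt \<mu>) f = cone_sum U (wt \<mu>) f"
    using assms f_closed by (intro cone_sum_mono_neutral) (auto simp: atoms_def)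
  then show ?thesis using assms(1) by (simp add: extension_def barycentre_def)
qed

lemma extension_closed: "extension X f \<in> fin_prob X \<rightarrow>\<^sub>E A"
proof
  fix \<mu> assume \<mu>: "\<mu> \<in> fin_prob X"
  note at = finite_atoms(1,2)[OF \<mu>]
  show "extension X f \<mu> \<in> A"
    using at f_closed sum_weights[OF \<mu> at(1) subset_refl] \<mu> unfolding extension_def
    by (auto intro!: barycentre(1))
qed (simp add: extension_def)

lemma extension_dirac:
  assumes "x \<in> mspace X"
  shows "extension X f (dirac X x) = f x"
proof -
  have "extension X f (dirac X x) = barycentre {x} (wt (dirac X x)) f"
    using assms atoms_dirac[OF p assms] dirac_fin_prob by (intro extension_eq) auto
  also have "cone_sum {x} (wt (dirac X x)) f = weighted 1 (f x) \<otimes>\<^bsub>cone\<^esub> cone_sum {} (wt (dirac X x)) f"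
    using assms f_closed by (subst cone_sum_insert) (auto simp: measure_dirac)
  then have "barycentre {x} (wt (dirac X x)) f = f x"
    by (simp add: barycentre_def weighted_def cone_sum_def)
  finally show ?thesis .
qed

lemma extension_affine: "affine_map (fin_prob X) mix bary (extension X f)"
  unfolding affine_map_def
proof (intro ballI)
  fix r :: real and \<mu> \<nu> assume r: "r \<in> {0..1}" and mem: "\<mu> \<in> fin_prob X" "\<nu> \<in> fin_prob X"
  note mix = mix_fin_prob[OF mem r]
  define U where "U = atoms \<mu> \<union> atoms \<nu>"
  have U: "finite U" "U \<subseteq> mspace X" "atoms \<mu> \<subseteq> U" "atoms \<nu> \<subseteq> U"
    using finite_atoms(1,2)[OF mem(1)] finite_atoms(1,2)[OF mem(2)] by (auto simp: U_def)
  have "atoms (mix r \<mu> \<nu>) \<subseteq> U" by (auto simp: U_def atoms_def mix)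
  then have "extension X f (mix r \<mu> \<nu>) = barycentre U (\<lambda>x. r * wt \<mu> x + (1 - r) * wt \<nu> x) f"
    using extension_eq[OF mix(1) U(1,2)] by (simp add: mix)
  also have "\<dots> = bary r (barycentre U (wt \<mu>) f) (barycentre U (wt \<nu>) f)"
    using U f_closed r sum_weights[OF mem(1) U(1,3)] sum_weights[OF mem(2) U(1,4)]
    by (intro barycentre_mix) auto
  finally show "extension X f (mix r \<mu> \<nu>) = bary r (extension X f \<mu>) (extension X f \<nu>)"
    using extension_eq[OF mem(1) U(1,2,3)] extension_eq[OF mem(2) U(1,2,4)] by simp
qed

text \<open>A plan rewrites both images as barycentres over the same weights on \<open>U \<times> U\<close>, so that
  the Wasserstein inequality applies term by term.\<close>

lemma extension_nonexpansive:
  "nonexpansive (fin_prob X) (wasserstein_dist p X) A d (extension X f)"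
  unfolding nonexpansive_def
proof (intro conjI ballI)
  show "extension X f \<in> fin_prob X \<rightarrow> A" using extension_closed by auto
  fix \<mu> \<nu> assume mem: "\<mu> \<in> fin_prob X" "\<nu> \<in> fin_prob X"
  define U where "U = atoms \<mu> \<union> atoms \<nu>"
  have U: "finite U" "U \<subseteq> mspace X" "atoms \<mu> \<subseteq> U" "atoms \<nu> \<subseteq> U"
    using finite_atoms(1,2)[OF mem(1)] finite_atoms(1,2)[OF mem(2)] by (auto simp: U_def)
  show "d (extension X f \<mu>) (extension X f \<nu>) \<le> wasserstein_dist p X \<mu> \<nu>"
  proof (rule wasserstein_dist_ge[OF U(1,2) mem(1) U(3) mem(2) U(4) p])
    fix g assume g: "plan U (wt \<mu>) (wt \<nu>) g"
    let ?w = "\<lambda>z. g (fst z) (snd z)"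
    let ?a = "\<lambda>z :: 'x \<times> 'x. f (fst z)" and ?b = "\<lambda>z :: 'x \<times> 'x. f (snd z)"
    have w: "0 \<le> ?w z" if "z \<in> U \<times> U" for z using g that by (auto simp: plan_def)
    have ab: "?a z \<in> A" "?b z \<in> A" if "z \<in> U \<times> U" for z using that U(2) f_closed by auto
    have fU: "f x \<in> A" if "x \<in> U" for x using that U(2) f_closed by auto
    have fin: "finite (U \<times> U)" using U(1) by simp
    \<comment> \<open>The fibre of \<open>fst\<close> over x is row x of the plan, so pushing the
      weights forward along \<open>fst\<close> recovers those of \<open>\<mu>\<close>. In the same
      way \<open>snd\<close> and the columns recover \<open>\<nu>\<close> below.\<close>
    have "(\<Sum>z | z \<in> U \<times> U \<and> fst z = x. ?w z) = wt \<mu> x" if "x \<in> U" for x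
    proof -
      have "{z. z \<in> U \<times> U \<and> fst z = x} = Pair x ` U" using that by auto
      then show ?thesis using g that by (simp add: sum.reindex inj_on_def plan_def)
    qed
    then have "cone_sum U (\<lambda>x. \<Sum>z | z \<in> U \<times> U \<and> fst z = x. ?w z) f = cone_sum U (wt \<mu>) f"
      using fU by (intro cone_sum_cong) auto
    then have eq_a: "extension X f \<mu> = barycentre (U \<times> U) ?w ?a"
      using cone_sum_pushforward[of "U \<times> U" U fst f ?w] fin U(1) fU w
        extension_eq[OF mem(1) U(1,2,3)] by (simp add: barycentre_def Pi_iff)
    have "(\<Sum>z | z \<in> U \<times> U \<and> snd z = y. ?w z) = wt \<nu> y" if "y \<in> U" for y
    proof -
      have "{z. z \<in> U \<times> U \<and> snd z = y} = (\<lambda>x. (x, y)) ` U" using that by auto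
      then show ?thesis using g that by (simp add: sum.reindex inj_on_def plan_def)
    qed
    then have "cone_sum U (\<lambda>y. \<Sum>z | z \<in> U \<times> U \<and> snd z = y. ?w z) f = cone_sum U (wt \<nu>) f"
      using fU by (intro cone_sum_cong) auto
    then have eq_b: "extension X f \<nu> = barycentre (U \<times> U) ?w ?b"
      using cone_sum_pushforward[of "U \<times> U" U snd f ?w] fin U(1) fU w
        extension_eq[OF mem(2) U(1,2,4)] by (simp add: barycentre_def Pi_iff)
    have "sum ?w (U \<times> U) = (\<Sum>x\<in>U. \<Sum>y\<in>U. g x y)"
      by (simp add: sum.cartesian_product case_prod_beta)
    also have "\<dots> = 1" using g sum_weights[OF mem(1) U(1,3)] by (simp add: plan_def)
    finally have total: "sum ?w (U \<times> U) = 1" .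
    have "ennpowr (d (extension X f \<mu>) (extension X f \<nu>)) p
        \<le> (\<Sum>z\<in>U \<times> U. ennreal (?w z) * ennpowr (d (?a z) (?b z)) p)"
      using barycentre_dist[of "U \<times> U" ?w ?a ?b, OF fin w ab] total eq_a eq_b by simp
    \<comment> \<open>Only here does nonexpansiveness of \<open>f\<close> enter, term by term; it
      also makes each distance in the sum finite.\<close>
    also have "\<dots> \<le> (\<Sum>z\<in>U \<times> U. ennreal (?w z) * ennreal (mdist X (fst z) (snd z) powr p))"
    proof (intro sum_mono mult_left_mono)
      fix z assume "z \<in> U \<times> U"
      then have "fst z \<in> mspace X" "snd z \<in> mspace X" using U(2) by auto
      then have "d (?a z) (?b z) \<le> ennreal (mdist X (fst z) (snd z))"
        using f by (simp add: nonexpansive_def)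
      then have "ennpowr (d (?a z) (?b z)) p \<le> ennpowr (ennreal (mdist X (fst z) (snd z))) p"
        using p by (intro ennpowr_mono) auto
      then show "ennpowr (d (?a z) (?b z)) p \<le> ennreal (mdist X (fst z) (snd z) powr p)"
        by (simp add: ennpowr_ennreal)
    qed simp
    also have "\<dots> = (\<Sum>z\<in>U \<times> U. ennreal (?w z * mdist X (fst z) (snd z) powr p))"
      using w by (intro sum.cong refl) (simp add: ennreal_mult)
    also have "\<dots> = ennreal (cost p X U g)"
      unfolding cost_def sum.cartesian_product using w by (subst sum_ennreal) (auto simp: case_prod_beta)
    finally have "d (extension X f \<mu>) (extension X f \<nu>) \<le> ennpowr (ennreal (cost p X U g)) (1 / p)"
      using p by (subst (asm) ennpowr_le_iff) auto
    then show "d (extension X f \<mu>) (extension X f \<nu>) \<le> ennreal (cost p X U g powr (1 / p))"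
      using cost_nonneg[OF g] by (simp add: ennpowr_ennreal)
  qed
qed

end

end

theorem theorem3p7:
  fixes X :: "'a metric" and p :: real
  assumes "p \<ge> 1"
  shows "wasserstein_algebra p (fin_prob X) (wasserstein_dist p X) mix \<and>
    nonexpansive (mspace X) (\<lambda>x y. ennreal (mdist X x y))
      (fin_prob X) (wasserstein_dist p X) (dirac X) \<and>
    (\<forall>(B :: 'b set) dB baryB f.
      wasserstein_algebra p B dB baryB \<longrightarrow>
      nonexpansive (mspace X) (\<lambda>x y. ennreal (mdist X x y)) B dB f \<longrightarrow>
      (\<exists>!h. h \<in> fin_prob X \<rightarrow>\<^sub>E B \<and>
        nonexpansive (fin_prob X) (wasserstein_dist p X) B dB h \<and>
        affine_map (fin_prob X) mix baryB h \<and>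
        (\<forall>x\<in>mspace X. h (dirac X x) = f x)))"
proof (intro conjI allI impI)
  show "wasserstein_algebra p (fin_prob X) (wasserstein_dist p X) mix"
    by (rule wasserstein_algebra_fin_prob[OF assms])
  show "nonexpansive (mspace X) (\<lambda>x y. ennreal (mdist X x y))
      (fin_prob X) (wasserstein_dist p X) (dirac X)"
    by (rule nonexpansive_dirac[OF assms])
  fix B :: "'b set" and dB baryB f
  assume "wasserstein_algebra p B dB baryB"
    and f: "nonexpansive (mspace X) (\<lambda>x y. ennreal (mdist X x y)) B dB f"
  then interpret B: wasserstein_algebra p B dB baryB by simp
  show "\<exists>!h. h \<in> fin_prob X \<rightarrow>\<^sub>E B \<and>
      nonexpansive (fin_prob X) (wasserstein_dist p X) B dB h \<and>
      affine_map (fin_prob X) mix baryB h \<and> (\<forall>x\<in>mspace X. h (dirac X x) = f x)"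
  proof (rule ex1I[of _ "B.extension X f"], intro conjI ballI)
    show "B.extension X f \<in> fin_prob X \<rightarrow>\<^sub>E B"
      by (rule B.extension_closed[OF assms f])
    show "nonexpansive (fin_prob X) (wasserstein_dist p X) B dB (B.extension X f)"
      by (rule B.extension_nonexpansive[OF assms f])
    show affine: "affine_map (fin_prob X) mix baryB (B.extension X f)"
      by (rule B.extension_affine[OF assms f])
    show dirac: "B.extension X f (dirac X x) = f x" if "x \<in> mspace X" for x
      by (rule B.extension_dirac[OF assms f that])
    fix h
    assume h: "h \<in> fin_prob X \<rightarrow>\<^sub>E B \<and>
      nonexpansive (fin_prob X) (wasserstein_dist p X) B dB h \<and>
      affine_map (fin_prob X) mix baryB h \<and> (\<forall>x\<in>mspace X. h (dirac X x) = f x)"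
    show "h = B.extension X f"
    \<comment> \<open>Both maps are extensional, so agreement on \<open>fin_prob X\<close> makes
      them equal.\<close>
    proof (rule PiE_ext)
      show "h \<in> fin_prob X \<rightarrow>\<^sub>E B" using h by simp
      show "B.extension X f \<in> fin_prob X \<rightarrow>\<^sub>E B" by (rule B.extension_closed[OF assms f])
      have "h (dirac X x) = B.extension X f (dirac X x)" if "x \<in> mspace X" for x
        using h dirac[OF that] that by simp
      with h affine show "h \<mu> = B.extension X f \<mu>" if "\<mu> \<in> fin_prob X" for \<mu>
        using affine_map_determined_by_dirac[OF _ affine _ that] by blast
    qed
  qed
qed

end
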